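(* Let $K$ be a global function field, fix a prime $\infty$ of $K$, let $\mathcal{O}$ be the ring of elements of $K$ regular at every prime other than $\infty$, and let $\mathbb{F}_q$ be the full constant field of $K$ (so $\mathcal{O}^*=\mathbb{F}_q^*$). If $\phi\in\mathcal{O}[X]$ is a polynomial of degree $d\geqslant 2$ with leading coefficient in $\mathcal{O}^*$, then \[\#\mathrm{Per}(\phi,K)\leqslant (q-1)(d-1)+1.\]
   Context: A global function field is a finite extension of $\mathbb{F}_p(t)$; the full constant field is the algebraic closure of $\mathbb{F}_p$ in $K$. $\mathrm{Per}(\phi,K)$ is the set of $x\in K$ with $\phi^n(x)=x$ for some $n\geqslant1$ ($\phi$ viewed as a map $K\to K$). *)

theory Defs
  imports "HOL-Computational_Algebra.Polynomial"
begin

definition prime_subfield :: "'a::field set" where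
  "prime_subfield = {of_int m / of_int n | m n. True}"

definition poly_over :: "'a::field set \<Rightarrow> 'a poly set" where
  "poly_over S = {f. \<forall>i. coeff f i \<in> S}"

definition transcendental_over_prime :: "'a::field \<Rightarrow> bool" where
  "transcendental_over_prime t \<longleftrightarrow>
     (\<forall>f \<in> poly_over prime_subfield. poly f t = 0 \<longrightarrow> f = 0)"

definition rat_fun_subfield :: "'a::field \<Rightarrow> 'a set" where
  "rat_fun_subfield t =
     {poly f t / poly g t | f g. f \<in> poly_over prime_subfield \<and> g \<in> poly_over prime_subfield}"

definition global_function_field :: "'a::field itself \<Rightarrow> bool" where
  "global_function_field _ \<longleftrightarrow>
     prime CHAR('a) \<and>
     (\<exists>t::'a. transcendental_over_prime t \<and>
        (\<exists>B. finite B \<and> (\<forall>x. \<exists>c. (\<forall>b\<in>B. c b \<in> rat_fun_subfield t) \<and>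
                                       x = (\<Sum>b\<in>B. c b * b))))"

text \<open>A prime (place) of K, represented by its normalized discrete valuation
  v : K^* \<rightarrow> Z (surjective); the value at 0 is irrelevant.\<close>
definition discrete_valuation :: "('a::field \<Rightarrow> int) \<Rightarrow> bool" where
  "discrete_valuation v \<longleftrightarrow>
     (\<forall>x y. x \<noteq> 0 \<longrightarrow> y \<noteq> 0 \<longrightarrow> v (x * y) = v x + v y) \<and>
     (\<forall>x y. x \<noteq> 0 \<longrightarrow> y \<noteq> 0 \<longrightarrow> x + y \<noteq> 0 \<longrightarrow> v (x + y) \<ge> min (v x) (v y)) \<and>
     (\<forall>n. \<exists>x. x \<noteq> 0 \<and> v x = n)"

definition same_prime :: "('a::field \<Rightarrow> int) \<Rightarrow> ('a \<Rightarrow> int) \<Rightarrow> bool" where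
  "same_prime v w \<longleftrightarrow> (\<forall>x. x \<noteq> 0 \<longrightarrow> v x = w x)"

definition ring_away_from :: "('a::field \<Rightarrow> int) \<Rightarrow> 'a set" where
  "ring_away_from vinf =
     {x. x = 0 \<or> (\<forall>w. discrete_valuation w \<and> \<not> same_prime w vinf \<longrightarrow> w x \<ge> 0)}"

definition constant_field :: "'a::field set" where
  "constant_field = {x. \<exists>f \<in> poly_over prime_subfield. f \<noteq> 0 \<and> poly f x = 0}"

definition Per :: "('a \<Rightarrow> 'a) \<Rightarrow> 'a set" where
  "Per \<phi> = {x. \<exists>n\<ge>1. (\<phi> ^^ n) x = x}"

end

theory Submission
  imports Defs
begin

text \<open>
  Periodic points lie in \<open>O\<close>, since a pole of \<open>x\<close> would get worse under iteration. For periodic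
  \<open>x \<noteq> y\<close> the difference \<open>x - y\<close> divides \<open>\<phi>(x) - \<phi>(y)\<close> in \<open>O\<close>, and going round a common
  period the quotient is a unit, so a nonzero constant \<open>c\<close>. For fixed \<open>y\<close> and \<open>c\<close>, the equation
  \<open>\<phi>(x) - \<phi>(y) = c (x - y)\<close> has at most \<open>d - 1\<close> solutions \<open>x \<noteq> y\<close>, all roots of
  \<open>(\<phi>(X) - \<phi>(y)) / (X - y) - c\<close>, and there are \<open>q - 1\<close> choices of \<open>c\<close>.

  A unit \<open>u\<close> of \<open>O\<close> is constant because a transcendental \<open>u\<close> has a zero and a pole, which are
  different primes. To obtain a zero, take a subring maximal among those in which \<open>u\<close> is not
  invertible; it is a valuation ring, and it is discrete because \<open>K\<close> is finite over \<open>F(u)\<close>,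
  with \<open>F\<close> the prime field.
\<close>

section \<open>Subrings of a field\<close>

locale field_subring =
  fixes A :: "'a::field set"
  assumes one_mem: "1 \<in> A"
    and diff_mem: "x \<in> A \<Longrightarrow> y \<in> A \<Longrightarrow> x - y \<in> A"
    and mult_mem: "x \<in> A \<Longrightarrow> y \<in> A \<Longrightarrow> x * y \<in> A"
begin

lemma zero_mem: "0 \<in> A"
  using diff_mem[OF one_mem one_mem] by simp

lemma uminus_mem: "x \<in> A \<Longrightarrow> - x \<in> A"
  using diff_mem[OF zero_mem, of x] by simp

lemma add_mem: "x \<in> A \<Longrightarrow> y \<in> A \<Longrightarrow> x + y \<in> A"
  using diff_mem[of x "- y"] uminus_mem[of y] by simp

lemma power_mem: "x \<in> A \<Longrightarrow> x ^ n \<in> A"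
  by (induction n) (auto simp: one_mem mult_mem)

lemma sum_mem: "(\<And>i. i \<in> I \<Longrightarrow> f i \<in> A) \<Longrightarrow> sum f I \<in> A"
  by (induction I rule: infinite_finite_induct) (auto simp: zero_mem add_mem)

lemma poly_mem: "f \<in> poly_over A \<Longrightarrow> x \<in> A \<Longrightarrow> poly f x \<in> A"
  unfolding poly_altdef by (intro sum_mem mult_mem power_mem) (auto simp: poly_over_def)

text \<open>Pigeonhole on the powers of \<open>x\<close>: a repetition makes some positive power
  equal to 1, so the inverse is itself a power of \<open>x\<close>. For \<open>x = 0\<close> the
  inverse is 0 by convention.\<close>

lemma inverse_mem_of_finite:
  assumes "finite A" "x \<in> A"
  shows "inverse x \<in> A"
proof (cases "x = 0")
  case False
  have "\<not> inj (\<lambda>n. x ^ n)"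
    using finite_subset[of "range (\<lambda>n. x ^ n)" A] assms power_mem finite_imageD by blast
  then obtain a b where ab: "x ^ a = x ^ b" "a < b"
    unfolding inj_def by (metis linorder_neqE_nat)
  have "x ^ a * x ^ (b - a) = x ^ a * 1"
    using ab by (metis le_add_diff_inverse less_imp_le mult_1_right power_add)
  hence "x ^ (b - a) = 1" using False by simp
  moreover have "b - a = Suc (b - a - 1)" using ab by simp
  ultimately have "x * x ^ (b - a - 1) = 1" by (metis power_Suc)
  hence "inverse x = x ^ (b - a - 1)" by (rule inverse_unique)
  thus ?thesis using power_mem[OF assms(2)] by simp
qed (simp add: zero_mem)

section \<open>Polynomials with coefficients in a subring\<close>

lemma poly_over_0: "0 \<in> poly_over A"
  by (simp add: poly_over_def zero_mem)

lemma poly_over_pCons: "pCons a p \<in> poly_over A \<longleftrightarrow> a \<in> A \<and> p \<in> poly_over A"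
  by (auto simp: poly_over_def coeff_pCons split: nat.splits)

lemma poly_over_diff: "f \<in> poly_over A \<Longrightarrow> g \<in> poly_over A \<Longrightarrow> f - g \<in> poly_over A"
  by (simp add: poly_over_def diff_mem)

lemma poly_over_add: "f \<in> poly_over A \<Longrightarrow> g \<in> poly_over A \<Longrightarrow> f + g \<in> poly_over A"
  by (simp add: poly_over_def add_mem)

lemma poly_over_smult: "a \<in> A \<Longrightarrow> g \<in> poly_over A \<Longrightarrow> smult a g \<in> poly_over A"
  by (simp add: poly_over_def mult_mem)

lemma poly_over_mult: "f \<in> poly_over A \<Longrightarrow> g \<in> poly_over A \<Longrightarrow> f * g \<in> poly_over A"
  by (simp add: poly_over_def coeff_mult sum_mem mult_mem)

lemma poly_over_monom: "a \<in> A \<Longrightarrow> monom a n \<in> poly_over A"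
  by (simp add: poly_over_def zero_mem)

lemma poly_over_sum: "(\<And>i. i \<in> I \<Longrightarrow> f i \<in> poly_over A) \<Longrightarrow> sum f I \<in> poly_over A"
  by (simp add: poly_over_def coeff_sum sum_mem)

text \<open>More unknowns (\<open>I\<close>) than homogeneous equations (\<open>B\<close>). Gaussian
  elimination without division keeps the solution in the ring \<open>A\<close>, which need not be a
  field.\<close>

lemma linear_relation:
  fixes a :: "'i \<Rightarrow> 'b \<Rightarrow> 'a"
  assumes "finite B" "finite I" "card B < card I" "\<And>i b. i \<in> I \<Longrightarrow> b \<in> B \<Longrightarrow> a i b \<in> A"
  shows "\<exists>c. (\<forall>i\<in>I. c i \<in> A) \<and> (\<exists>i\<in>I. c i \<noteq> 0) \<and> (\<forall>b\<in>B. (\<Sum>i\<in>I. c i * a i b) = 0)"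
  using assms
proof (induction B arbitrary: I a rule: finite_induct)
  case empty
  then show ?case by (intro exI[of _ "\<lambda>_. 1"]) (auto simp: one_mem card_gt_0_iff)
next
  case (insert b0 B)
  show ?case
  proof (cases "\<forall>i\<in>I. a i b0 = 0")
    case True
    have "card B < card I" using insert by simp
    from insert.IH[OF insert.prems(1) this, of a] insert.prems(3)
    obtain c where "\<forall>i\<in>I. c i \<in> A" "\<exists>i\<in>I. c i \<noteq> 0" "\<forall>b\<in>B. (\<Sum>i\<in>I. c i * a i b) = 0"
      by auto
    thus ?thesis using True by (intro exI[of _ c]) auto
  next
    case False
    then obtain k where k: "k \<in> I" "a k b0 \<noteq> 0" by auto
    define I' where "I' = I - {k}"
    define a' where "a' = (\<lambda>i b. a k b0 * a i b - a i b0 * a k b)"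
    have I': "finite I'" "card B < card I'" "\<And>i. i \<in> I' \<Longrightarrow> i \<in> I \<and> i \<noteq> k"
      using insert k by (auto simp: I'_def)
    have "a' i b \<in> A" if "i \<in> I'" "b \<in> B" for i b
      unfolding a'_def using that I'(3) k insert.prems(3) by (auto intro!: diff_mem mult_mem)
    from insert.IH[where a = a', OF I'(1,2) this]
    obtain c' where c': "\<forall>i\<in>I'. c' i \<in> A" "\<exists>i\<in>I'. c' i \<noteq> 0" "\<forall>b\<in>B. (\<Sum>i\<in>I'. c' i * a' i b) = 0"
      by blast
    \<comment> \<open>The value at the pivot index \<open>k\<close> is chosen to satisfy equation
      \<open>b0\<close>; the others are scaled by the pivot so that no division occurs.\<close>
    define c where "c = (\<lambda>i. if i = k then - (\<Sum>i\<in>I'. c' i * a i b0) else a k b0 * c' i)"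
    have "(\<Sum>i\<in>I. c i * a i b) = (\<Sum>i\<in>I'. c' i * a' i b)" for b
    proof -
      have "(\<Sum>i\<in>I. c i * a i b) = c k * a k b + (\<Sum>i\<in>I'. c i * a i b)"
        unfolding I'_def using insert.prems(1) k(1) by (rule sum.remove)
      also have "(\<Sum>i\<in>I'. c i * a i b) = (\<Sum>i\<in>I'. a k b0 * c' i * a i b)"
        using I'(3) by (intro sum.cong) (auto simp: c_def)
      also have "c k * a k b = - (\<Sum>i\<in>I'. c' i * a i b0 * a k b)"
        by (simp add: c_def sum_distrib_right)
      finally show ?thesis
        by (simp add: a'_def algebra_simps flip: sum_subtractf)
    qed
    moreover have "(\<Sum>i\<in>I'. c' i * a' i b0) = 0" by (simp add: a'_def mult.commute)
    moreover have "c i \<in> A" if "i \<in> I" for i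
    proof (cases "i = k")
      case True
      have "(\<Sum>i\<in>I'. c' i * a i b0) \<in> A"
        using c'(1) I'(3) insert.prems(3) by (intro sum_mem mult_mem) auto
      then show ?thesis using True by (simp add: c_def uminus_mem)
    next
      case False
      then show ?thesis
        using that c'(1) insert.prems(3) k(1) by (simp add: c_def I'_def mult_mem)
    qed
    moreover have "\<exists>i\<in>I. c i \<noteq> 0"
    proof -
      obtain i where "i \<in> I'" "c' i \<noteq> 0" using c'(2) by blast
      thus ?thesis using I'(3) k by (intro bexI[of _ i]) (auto simp: c_def)
    qed
    ultimately show ?thesis using c'(3) by (intro exI[of _ c]) auto
  qed
qed

text \<open>Each \<open>D * x i\<close> is an \<open>A\<close>-combination of the fewer elements
  \<open>y b\<close>, so a relation among the coefficient rows is one among the \<open>x i\<close>;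
  the nonzero \<open>D\<close> cancels at the end.\<close>

lemma linear_relation_of_span:
  fixes a :: "'i \<Rightarrow> 'b \<Rightarrow> 'a"
  assumes "finite B" "finite I" "card B < card I" "\<And>i b. i \<in> I \<Longrightarrow> b \<in> B \<Longrightarrow> a i b \<in> A"
    and "D \<noteq> 0" "\<And>i. i \<in> I \<Longrightarrow> D * x i = (\<Sum>b\<in>B. a i b * y b)"
  shows "\<exists>c. (\<forall>i\<in>I. c i \<in> A) \<and> (\<exists>i\<in>I. c i \<noteq> 0) \<and> (\<Sum>i\<in>I. c i * x i) = 0"
proof -
  obtain c where c: "\<forall>i\<in>I. c i \<in> A" "\<exists>i\<in>I. c i \<noteq> 0" "\<forall>b\<in>B. (\<Sum>i\<in>I. c i * a i b) = 0"
    using linear_relation[where a = a, OF assms(1-4)] by blast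
  have "D * (\<Sum>i\<in>I. c i * x i) = (\<Sum>i\<in>I. c i * (D * x i))"
    by (simp add: sum_distrib_left mult_ac)
  also have "\<dots> = (\<Sum>i\<in>I. \<Sum>b\<in>B. c i * a i b * y b)"
    by (simp add: assms(6) sum_distrib_left mult_ac)
  also have "\<dots> = (\<Sum>b\<in>B. (\<Sum>i\<in>I. c i * a i b) * y b)"
    by (subst sum.swap) (simp add: sum_distrib_right)
  also have "\<dots> = 0" using c(3) by simp
  finally have "(\<Sum>i\<in>I. c i * x i) = 0" using assms(5) by simp
  thus ?thesis using c by auto
qed

text \<open>The product of the individual denominators works. \<open>M\<close> is only asked to be
  stable under multiplication by \<open>A\<close>, which allows modules as well as rings.\<close>

lemma common_denominator:
  assumes "finite X" "\<And>x. x \<in> X \<Longrightarrow> \<exists>d\<in>A. d \<noteq> 0 \<and> d * x \<in> M"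
    and "\<And>a y. a \<in> A \<Longrightarrow> y \<in> M \<Longrightarrow> a * y \<in> M"
  shows "\<exists>d\<in>A. d \<noteq> 0 \<and> (\<forall>x\<in>X. d * x \<in> M)"
  using assms(1,2)
proof (induction X rule: finite_induct)
  case empty
  then show ?case using one_mem by (intro bexI[of _ 1]) auto
next
  case (insert x X)
  then obtain d e where d: "d \<in> A" "d \<noteq> 0" "\<forall>x\<in>X. d * x \<in> M" and e: "e \<in> A" "e \<noteq> 0" "e * x \<in> M"
    by (metis insertCI)
  have "d * e * y \<in> M" if "y \<in> insert x X" for y
  proof (cases "y = x")
    case True
    then show ?thesis using assms(3)[OF d(1) e(3)] by (simp add: mult_ac)
  next
    case False
    then show ?thesis using that assms(3)[OF e(1), of "d * y"] d(3) by (simp add: mult_ac)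
  qed
  then show ?case using d e mult_mem by (intro bexI[of _ "d * e"]) auto
qed

text \<open>Pseudo-division by \<open>Q\<close>, evaluated at a root of \<open>Q\<close>.\<close>

lemma reduce_at_root:
  assumes "Q \<in> poly_over A" "poly Q t = 0" "f \<in> poly_over A"
  shows "\<exists>e r. r \<in> poly_over A \<and> (\<forall>i\<ge>degree Q. coeff r i = 0) \<and> lead_coeff Q ^ e * poly f t = poly r t"
  using assms(3)
proof (induction f)
  case 0
  then show ?case using poly_over_0 by (intro exI[of _ 0]) auto
next
  case (pCons a p)
  let ?h = "lead_coeff Q" and ?n = "degree Q"
  have h: "?h \<in> A" using assms(1) by (auto simp: poly_over_def)
  obtain e r where r: "r \<in> poly_over A" "\<forall>i\<ge>?n. coeff r i = 0" "?h ^ e * poly p t = poly r t"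
    using pCons by (auto simp: poly_over_pCons)
  define s where "s = pCons (?h ^ e * a) r"
  define r' where "r' = smult ?h s - smult (coeff s ?n) Q"
  have s: "s \<in> poly_over A"
    using r pCons.prems h by (auto simp: s_def poly_over_pCons intro!: mult_mem power_mem)
  hence "r' \<in> poly_over A"
    unfolding r'_def using h assms(1) by (intro poly_over_diff poly_over_smult) (auto simp: poly_over_def)
  moreover have "coeff r' i = 0" if "i \<ge> ?n" for i
  proof (cases "i = ?n")
    case False
    hence "coeff s i = 0" "coeff Q i = 0"
      using that r(2) by (auto simp: s_def coeff_pCons coeff_eq_0 split: nat.splits)
    thus ?thesis by (simp add: r'_def)
  qed (simp add: r'_def)
  moreover have "poly s t = ?h ^ e * poly (pCons a p) t"
    using r(3) by (simp add: s_def algebra_simps)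
  hence "?h ^ Suc e * poly (pCons a p) t = poly r' t"
    by (simp add: r'_def assms(2) mult_ac)
  ultimately show ?case by blast
qed

lemma finite_poly_over_bounded:
  assumes "finite A"
  shows "finite {r \<in> poly_over A. \<forall>i\<ge>n. coeff r i = 0}"
proof (rule finite_subset)
  show "{r \<in> poly_over A. \<forall>i\<ge>n. coeff r i = 0} \<subseteq> Poly ` {xs. set xs \<subseteq> A \<and> length xs = n}"
  proof
    fix r assume r: "r \<in> {r \<in> poly_over A. \<forall>i\<ge>n. coeff r i = 0}"
    have "r = Poly (map (coeff r) [0..<n])"
      using r by (intro poly_eqI) (auto simp: coeff_Poly_eq nth_default_def)
    moreover have "set (map (coeff r) [0..<n]) \<subseteq> A" using r by (auto simp: poly_over_def)
    ultimately show "r \<in> Poly ` {xs. set xs \<subseteq> A \<and> length xs = n}" by force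
  qed
  show "finite (Poly ` {xs. set xs \<subseteq> A \<and> length xs = n})"
    using finite_lists_length_eq[OF assms] by simp
qed

end

section \<open>Rings generated by one element\<close>

definition adjoin :: "'a::field set \<Rightarrow> 'a \<Rightarrow> 'a set" where
  "adjoin A t = (\<lambda>f. poly f t) ` poly_over A"

context field_subring
begin

lemma poly_mem_adjoin: "f \<in> poly_over A \<Longrightarrow> poly f t \<in> adjoin A t"
  by (auto simp: adjoin_def)

lemma subset_adjoin: "A \<subseteq> adjoin A t"
proof
  fix a assume "a \<in> A"
  hence "[:a:] \<in> poly_over A" by (simp add: poly_over_pCons poly_over_0)
  from poly_mem_adjoin[OF this, of t] show "a \<in> adjoin A t" by simp
qed

lemma gen_mem_adjoin: "t \<in> adjoin A t"
proof -
  have "[:0, 1:] \<in> poly_over A" by (simp add: poly_over_pCons poly_over_0 zero_mem one_mem)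
  from poly_mem_adjoin[OF this, of t] show ?thesis by simp
qed

lemma field_subring_adjoin: "field_subring (adjoin A t)"
proof
  show "1 \<in> adjoin A t" using subset_adjoin one_mem by blast
next
  fix x y assume "x \<in> adjoin A t" "y \<in> adjoin A t"
  then obtain f g where "f \<in> poly_over A" "g \<in> poly_over A" "x = poly f t" "y = poly g t"
    by (auto simp: adjoin_def)
  thus "x - y \<in> adjoin A t" "x * y \<in> adjoin A t"
    using poly_mem_adjoin[OF poly_over_diff, of f g t] poly_mem_adjoin[OF poly_over_mult, of f g t] by auto
qed

text \<open>In a finite ring the leading coefficient of \<open>Q\<close> is invertible, so
  pseudo-division becomes division and leaves only remainders of degree below that of
  \<open>Q\<close>, of which there are finitely many.\<close>

lemma finite_adjoin:
  assumes "finite A" "Q \<in> poly_over A" "Q \<noteq> 0" "poly Q t = 0"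
  shows "finite (adjoin A t)"
proof (rule finite_subset)
  let ?R = "{r \<in> poly_over A. \<forall>i\<ge>degree Q. coeff r i = 0}"
  show "adjoin A t \<subseteq> (\<lambda>r. poly r t) ` ?R"
  proof
    fix y assume "y \<in> adjoin A t"
    then obtain f where f: "f \<in> poly_over A" "y = poly f t" by (auto simp: adjoin_def)
    let ?h = "lead_coeff Q"
    obtain e r where r: "r \<in> poly_over A" "\<forall>i\<ge>degree Q. coeff r i = 0" "?h ^ e * poly f t = poly r t"
      using reduce_at_root[OF assms(2,4) f(1)] by blast
    have "?h ^ e \<in> A" using assms(2) power_mem by (auto simp: poly_over_def)
    hence "smult (inverse (?h ^ e)) r \<in> ?R"
      using r inverse_mem_of_finite[OF assms(1)] by (auto intro!: poly_over_smult)
    moreover have "?h \<noteq> 0" using assms(3) by simp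
    hence "y = poly (smult (inverse (?h ^ e)) r) t"
      using f(2) r(3) by (simp add: field_simps flip: r(3))
    ultimately show "y \<in> (\<lambda>r. poly r t) ` ?R" by blast
  qed
  show "finite ((\<lambda>r. poly r t) ` ?R)" using finite_poly_over_bounded[OF assms(1)] by simp
qed

text \<open>A two-variable polynomial, given by its coefficients \<open>f i\<close> as a polynomial in the second
  variable, is rewritten as a polynomial in the first one.\<close>

lemma swap_variables:
  assumes "\<And>i. i \<le> n \<Longrightarrow> f i \<in> poly_over A" "\<exists>i\<le>n. f i \<noteq> 0"
  obtains g m where "\<And>j. g j \<in> poly_over A" "\<And>j. degree (g j) \<le> n" "\<exists>j\<le>m. g j \<noteq> 0"
    "\<And>a b. (\<Sum>i\<le>n. poly (f i) a * b ^ i) = (\<Sum>j\<le>m. poly (g j) b * a ^ j)"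
proof -
  define m where "m = Max (degree ` f ` {..n})"
  define g where "g = (\<lambda>j. \<Sum>i\<le>n. monom (coeff (f i) j) i)"
  have m: "degree (f i) \<le> m" if "i \<le> n" for i
    unfolding m_def using that by (intro Max_ge) auto
  have "g j \<in> poly_over A" for j
    unfolding g_def using assms(1) by (intro poly_over_sum poly_over_monom) (auto simp: poly_over_def)
  moreover have "degree (g j) \<le> n" for j
    unfolding g_def by (rule degree_sum_le) (auto intro: order.trans[OF degree_monom_le])
  moreover have coeff_g: "coeff (g j) i = coeff (f i) j" if "i \<le> n" for i j
    using that by (simp add: g_def coeff_sum)
  have "\<exists>j\<le>m. g j \<noteq> 0"
  proof -
    obtain i where i: "i \<le> n" "f i \<noteq> 0" using assms(2) by auto
    hence "coeff (g (degree (f i))) i \<noteq> 0" by (simp add: coeff_g)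
    thus ?thesis using m[OF i(1)] by fastforce
  qed
  moreover have "(\<Sum>i\<le>n. poly (f i) a * b ^ i) = (\<Sum>j\<le>m. poly (g j) b * a ^ j)" for a b
  proof -
    have "poly (f i) a = (\<Sum>j\<le>m. coeff (f i) j * a ^ j)" if "i \<le> n" for i
      unfolding poly_altdef using m[OF that]
      by (intro sum.mono_neutral_left) (auto simp: coeff_eq_0)
    hence "(\<Sum>i\<le>n. poly (f i) a * b ^ i) = (\<Sum>i\<le>n. \<Sum>j\<le>m. coeff (f i) j * a ^ j * b ^ i)"
      by (intro sum.cong) (auto simp: sum_distrib_right)
    also have "\<dots> = (\<Sum>j\<le>m. \<Sum>i\<le>n. coeff (f i) j * a ^ j * b ^ i)" by (rule sum.swap)
    also have "\<dots> = (\<Sum>j\<le>m. poly (g j) b * a ^ j)"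
      by (simp add: g_def poly_sum poly_monom sum_distrib_left mult_ac)
    finally show ?thesis .
  qed
  ultimately show ?thesis using that by blast
qed

end

section \<open>The prime field\<close>

lemma finite_range_of_int:
  assumes "CHAR('a::field) > 0"
  shows "finite (range (of_int :: int \<Rightarrow> 'a))"
proof (rule finite_subset)
  let ?p = "int CHAR('a)"
  show "range (of_int :: int \<Rightarrow> 'a) \<subseteq> of_int ` {0..<?p}"
  proof
    fix x :: 'a assume "x \<in> range of_int"
    then obtain m where "x = of_int m" by auto
    also have "m = ?p * (m div ?p) + m mod ?p" by simp
    also have "of_int \<dots> = (of_int (m mod ?p) :: 'a)"
      unfolding of_int_add of_int_mult by simp
    finally show "x \<in> of_int ` {0..<?p}" using assms by auto
  qed
qed simp

lemma field_subring_range_of_int: "field_subring (range (of_int :: int \<Rightarrow> 'a::field))"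
proof
  show "1 \<in> range (of_int :: int \<Rightarrow> 'a)" by (metis of_int_1 rangeI)
qed (auto simp flip: of_int_diff of_int_mult)

text \<open>The image of the integers is a finite ring, hence closed under inverses, and the
  quotients add nothing new.\<close>

lemma prime_subfield_eq:
  assumes "CHAR('a::field) > 0"
  shows "(prime_subfield :: 'a set) = range of_int"
proof
  interpret field_subring "range (of_int :: int \<Rightarrow> 'a)" by (rule field_subring_range_of_int)
  show "prime_subfield \<subseteq> range (of_int :: int \<Rightarrow> 'a)"
    unfolding prime_subfield_def divide_inverse
    using mult_mem inverse_mem_of_finite[OF finite_range_of_int[OF assms]] by blast
  show "range of_int \<subseteq> (prime_subfield :: 'a set)"
    unfolding prime_subfield_def
  proof clarify
    fix m :: int
    have "(of_int m :: 'a) = of_int m / of_int 1" by simp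
    thus "\<exists>k n. (of_int m :: 'a) = of_int k / of_int n \<and> True" by blast
  qed
qed

section \<open>Valuation rings\<close>

context field_subring
begin

text \<open>Let \<open>b\<close> be the constant coefficient of \<open>g\<close> and
  \<open>n = degree f\<close>. Multiplied by \<open>x ^ n\<close>, the relation for
  \<open>inverse x\<close> becomes \<open>x ^ n * (1 - u * b) = u * poly g2 x\<close> with
  \<open>degree g2 < n\<close>. Multiplying \<open>u * poly f x = 1\<close> by
  \<open>1 - u * b\<close> therefore lets the leading term of \<open>f\<close> be replaced by lower
  ones.\<close>

lemma lower_degree_relation:
  assumes "u \<in> A" "x \<noteq> 0" "f \<in> poly_over A" "g \<in> poly_over A"
    and f: "u * poly f x = 1" and g: "u * poly g (inverse x) = 1"
    and deg: "degree g \<le> degree f" "degree f > 0"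
  obtains f' where "f' \<in> poly_over A" "u * poly f' x = 1" "degree f' < degree f"
proof -
  define n where "n = degree f"
  obtain b g1 where g1: "g = pCons b g1" by (cases g) auto
  have n: "n > 0" using deg by (simp add: n_def)
  have b: "b \<in> A" and g1_mem: "g1 \<in> poly_over A" using assms(4) g1 by (auto simp: poly_over_pCons)
  have deg_g1: "coeff g1 i = 0" if "i \<ge> n" for i
    using coeff_eq_0[of g "Suc i"] that deg by (simp add: n_def g1)
  \<comment> \<open>\<open>g2\<close> is \<open>g1\<close> reversed in length \<open>n\<close>:
    \<open>poly g2 x\<close> is \<open>x ^ (n - 1)\<close> times the value of \<open>g1\<close> at
    \<open>inverse x\<close>.\<close>
  define g2 where "g2 = (\<Sum>i<n. monom (coeff g1 (n - Suc i)) i)"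
  define a where "a = lead_coeff f"
  have a: "a \<in> A" using assms(3) by (auto simp: a_def poly_over_def)
  define f1 where "f1 = f - monom a n"
  \<comment> \<open>Read off from \<open>1 - u * b = u * ((1 - u * b) * f1 + u * a * g2)\<close> at
    \<open>x\<close> by moving \<open>u * b\<close> to the other side.\<close>
  define f' where "f' = [:b:] + smult (1 - u * b) f1 + smult (u * a) g2"
  have "poly g1 (inverse x) = (\<Sum>i<n. coeff g1 i * inverse x ^ i)"
    unfolding poly_altdef
  proof (rule sum.mono_neutral_cong)
    show "coeff g1 i * inverse x ^ i = 0" if "i \<in> {..<n} - {..degree g1}" for i
      using that by (simp add: coeff_eq_0)
    show "coeff g1 i * inverse x ^ i = 0" if "i \<in> {..degree g1} - {..<n}" for i
      using that deg_g1 by simp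
  qed auto
  hence "x ^ n * (inverse x * poly g1 (inverse x)) = (\<Sum>i<n. x ^ n * inverse x ^ Suc i * coeff g1 i)"
    by (simp add: sum_distrib_left mult_ac)
  also have "\<dots> = (\<Sum>i<n. x ^ (n - Suc i) * coeff g1 i)"
  proof (intro sum.cong refl arg_cong2[where f = "(*)"])
    fix i assume "i \<in> {..<n}"
    hence "x ^ n = x ^ (n - Suc i) * x ^ Suc i" by (simp flip: power_add del: power_Suc)
    thus "x ^ n * inverse x ^ Suc i = x ^ (n - Suc i)"
      using assms(2) by (simp add: power_inverse mult.assoc del: power_Suc)
  qed
  also have "\<dots> = (\<Sum>i<n. x ^ i * coeff g1 (n - Suc i))"
    by (subst sum.nat_diff_reindex[symmetric]) (auto intro!: sum.cong)
  also have "\<dots> = poly g2 x" by (simp add: g2_def poly_sum poly_monom mult_ac)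
  finally have g2: "x ^ n * (inverse x * poly g1 (inverse x)) = poly g2 x" .
  have f1: "poly f x = poly f1 x + a * x ^ n" by (simp add: f1_def poly_monom)
  have "1 - u * b = u * (inverse x * poly g1 (inverse x))"
    using g by (simp add: g1 algebra_simps)
  hence "x ^ n * (1 - u * b) = u * poly g2 x"
    using g2 by (simp add: mult_ac)
  moreover have "(1 - u * b) * (u * poly f x) = u * (1 - u * b) * poly f1 x + u * a * (x ^ n * (1 - u * b))"
    unfolding f1 by (simp add: algebra_simps)
  ultimately have "(1 - u * b) * (u * poly f x) = u * (1 - u * b) * poly f1 x + u * a * (u * poly g2 x)"
    by simp
  hence "u * poly f' x = 1"
    unfolding f by (simp add: f'_def algebra_simps)
  moreover have "f' \<in> poly_over A"
    unfolding f'_def f1_def g2_def using a b assms(1,3) g1_mem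
    by (intro poly_over_add poly_over_smult poly_over_diff poly_over_sum poly_over_monom mult_mem diff_mem one_mem)
      (auto simp: poly_over_pCons poly_over_0, auto simp: poly_over_def)
  moreover have "degree f' \<le> n - 1"
  proof (intro degree_le allI impI)
    fix i assume i: "n - 1 < i"
    hence "coeff f1 i = 0" by (cases "i = n") (auto simp: f1_def a_def n_def coeff_eq_0)
    thus "coeff f' i = 0" using i n by (auto simp: f'_def g2_def coeff_sum coeff_pCons split: nat.splits)
  qed
  hence "degree f' < degree f" using n by (simp add: n_def)
  ultimately show thesis using that by blast
qed

text \<open>Descent on the sum of the degrees: the larger degree is lowered, with the roles of
  \<open>x\<close> and \<open>inverse x\<close> exchanged when it belongs to \<open>g\<close>. Once
  one polynomial is constant, its value inverts \<open>u\<close>.\<close>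

lemma inverse_mem_of_two_relations:
  assumes "u \<in> A" "x \<noteq> 0" "f \<in> poly_over A" "g \<in> poly_over A"
    and "u * poly f x = 1" "u * poly g (inverse x) = 1"
  shows "inverse u \<in> A"
  using assms(2-)
proof (induction "degree f + degree g" arbitrary: x f g rule: less_induct)
  case less
  show ?case
  proof (cases "degree f = 0 \<or> degree g = 0")
    case True
    then obtain a where "a \<in> A" "u * a = 1"
      using less.prems
      by (elim disjE) (auto elim!: degree_eq_zeroE simp: poly_over_pCons)
    thus ?thesis using inverse_unique by metis
  next
    case False
    show ?thesis
    proof (cases "degree g \<le> degree f")
      case True
      obtain f' where "f' \<in> poly_over A" "u * poly f' x = 1" "degree f' < degree f"
        using lower_degree_relation[OF assms(1) less.prems True] False by blast
      with less.hyps[of f' g x] less.prems show ?thesis by simp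
    next
      case *: False
      obtain g' where "g' \<in> poly_over A" "u * poly g' (inverse x) = 1" "degree g' < degree g"
        using lower_degree_relation[of u "inverse x" g f] * assms(1) less.prems False by auto
      with less.hyps[of f g' x] less.prems show ?thesis by simp
    qed
  qed
qed

end

locale valuation_ring = field_subring +
  assumes mem_or_inverse_mem: "x \<noteq> 0 \<Longrightarrow> x \<in> A \<or> inverse x \<in> A"

text \<open>Zorn's lemma gives a subring \<open>M\<close> maximal among those that contain
  \<open>A\<close> but not \<open>inverse u\<close>. If neither \<open>x\<close> nor
  \<open>inverse x\<close> lay in \<open>M\<close>, adjoining either would produce
  \<open>inverse u\<close>, and the two resulting relations would put it into \<open>M\<close>
  itself.\<close>

lemma exists_valuation_ring:
  fixes u :: "'a::field"
  assumes "field_subring A" "u \<in> A" "inverse u \<notin> A"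
  obtains V where "valuation_ring V" "A \<subseteq> V" "inverse u \<notin> V"
proof -
  define S where "S = {B. field_subring B \<and> A \<subseteq> B \<and> inverse u \<notin> B}"
  have "\<exists>M\<in>S. \<forall>X\<in>S. M \<subseteq> X \<longrightarrow> X = M"
  proof (rule subset_Zorn_nonempty)
    show "S \<noteq> {}" using assms by (auto simp: S_def)
  next
    fix C assume C: "C \<noteq> {}" "subset.chain S C"
    have mem: "\<exists>B\<in>C. x \<in> B \<and> y \<in> B" if "x \<in> \<Union>C" "y \<in> \<Union>C" for x y
      using that C(2) unfolding subset.chain_def by blast
    have ring: "field_subring B" if "B \<in> C" for B
      using that C(2) by (auto simp: subset.chain_def S_def)
    have "field_subring (\<Union>C)"
    proof
      show "1 \<in> \<Union>C" using C(1) ring field_subring.one_mem by blast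
    next
      fix x y assume "x \<in> \<Union>C" "y \<in> \<Union>C"
      then obtain B where "B \<in> C" "x \<in> B" "y \<in> B" using mem by blast
      thus "x - y \<in> \<Union>C" "x * y \<in> \<Union>C"
        using field_subring.diff_mem[OF ring] field_subring.mult_mem[OF ring] by blast+
    qed
    moreover have "C \<subseteq> S" using C(2) by (simp add: subset.chain_def)
    hence "A \<subseteq> \<Union>C" "inverse u \<notin> \<Union>C"
      using C(1) unfolding S_def by blast+
    ultimately show "\<Union>C \<in> S" by (simp add: S_def)
  qed
  then obtain M where M: "M \<in> S" and max: "\<And>X. X \<in> S \<Longrightarrow> M \<subseteq> X \<Longrightarrow> X = M" by blast
  interpret field_subring M using M by (simp add: S_def)
  have u: "u \<in> M" "inverse u \<notin> M" "A \<subseteq> M" using M assms(2) by (auto simp: S_def)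
  hence u0: "u \<noteq> 0" using zero_mem by auto
  have rel: "\<exists>f\<in>poly_over M. u * poly f x = 1" if "x \<notin> M" for x
  proof -
    have "adjoin M x \<noteq> M" using that gen_mem_adjoin by blast
    hence "adjoin M x \<notin> S" using max[of "adjoin M x"] subset_adjoin by blast
    hence "inverse u \<in> adjoin M x"
      using field_subring_adjoin subset_adjoin[of x] u(3) by (auto simp: S_def)
    then obtain f where "f \<in> poly_over M" "inverse u = poly f x" by (auto simp: adjoin_def)
    moreover from this(2) have "u * poly f x = 1" using u0 by (metis right_inverse)
    ultimately show ?thesis by blast
  qed
  have "valuation_ring M"
  proof
    fix x :: 'a assume x: "x \<noteq> 0"
    show "x \<in> M \<or> inverse x \<in> M"
      using rel[of x] rel[of "inverse x"] inverse_mem_of_two_relations[OF u(1) x] u(2) by blast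
  qed
  thus thesis using that u by blast
qed

text \<open>For \<open>u\<close> transcendental over a field \<open>F\<close>, this bounds the
  degree over \<open>F(u)\<close> by \<open>n\<close>: any \<open>n + 1\<close> elements (the
  indices run from 0) are dependent, with the denominators of the coefficients cleared.\<close>

definition bounded_rank :: "'a::field set \<Rightarrow> 'a \<Rightarrow> nat \<Rightarrow> bool" where
  "bounded_rank F u n \<longleftrightarrow> (\<forall>x :: nat \<Rightarrow> 'a. \<exists>f. (\<forall>i\<le>n. f i \<in> poly_over F) \<and> (\<exists>i\<le>n. f i \<noteq> 0) \<and>
     (\<Sum>i\<le>n. poly (f i) u * x i) = 0)"

section \<open>Units and nonunits of a valuation ring\<close>

context valuation_ring
begin

definition units :: "'a set" where
  "units = {x \<in> A. x \<noteq> 0 \<and> inverse x \<in> A}"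

text \<open>This is the maximal ideal. In terms of values, \<open>x / y \<in> nonunits\<close> says
  for \<open>y \<noteq> 0\<close> that \<open>x\<close> has strictly larger value than
  \<open>y\<close>.\<close>

definition nonunits :: "'a set" where
  "nonunits = A - units"

lemma units_mult: "x \<in> units \<Longrightarrow> y \<in> units \<Longrightarrow> x * y \<in> units"
  by (auto simp: units_def mult_mem)

lemma units_inverse: "x \<in> units \<Longrightarrow> inverse x \<in> units"
  by (auto simp: units_def)

lemma units_divide: "x \<in> units \<Longrightarrow> y \<in> units \<Longrightarrow> x / y \<in> units"
  by (auto simp: divide_inverse units_mult units_inverse)

lemma one_unit: "1 \<in> units"
  by (simp add: units_def one_mem)

lemma unit_mem: "x \<in> units \<Longrightarrow> x \<in> A" "x \<in> units \<Longrightarrow> x \<noteq> 0"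
  by (auto simp: units_def)

lemma nonunit_mem: "x \<in> nonunits \<Longrightarrow> x \<in> A" "x \<in> nonunits \<Longrightarrow> x \<notin> units"
  by (auto simp: nonunits_def)

lemma zero_nonunit: "0 \<in> nonunits"
  by (auto simp: nonunits_def units_def zero_mem)

lemma nonunits_mult:
  assumes "x \<in> nonunits" "y \<in> A"
  shows "x * y \<in> nonunits"
proof (rule ccontr)
  assume "x * y \<notin> nonunits"
  hence *: "inverse (x * y) \<in> A" "x \<noteq> 0" "y \<noteq> 0"
    using assms by (auto simp: nonunits_def mult_mem units_def)
  hence "y * inverse (x * y) \<in> A" using assms mult_mem by blast
  also have "y * inverse (x * y) = inverse x" using * by (simp add: field_simps)
  finally show False using assms * by (auto simp: nonunits_def units_def)
qed

lemma inverse_nonunit: "x \<notin> A \<Longrightarrow> inverse x \<in> nonunits"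
  using mem_or_inverse_mem[of x] zero_mem by (auto simp: nonunits_def units_def)

lemma nonunits_add:
  assumes "x \<in> nonunits" "y \<in> nonunits"
  shows "x + y \<in> nonunits"
proof (cases "x = 0 \<or> y = 0")
  case False
  have *: "a + b \<in> nonunits" if "a / b \<in> A" "b \<in> nonunits" "b \<noteq> 0" for a b
  proof -
    have "b * (a / b + 1) \<in> nonunits" using that by (intro nonunits_mult add_mem one_mem)
    also have "b * (a / b + 1) = a + b" using that by (simp add: distrib_left)
    finally show ?thesis .
  qed
  show ?thesis
  proof (cases "x / y \<in> A")
    case True
    then show ?thesis using *[of x y] assms False by simp
  next
    case F: False
    hence "y / x \<in> A" using mem_or_inverse_mem[of "x / y"] False by simp
    then show ?thesis using *[of y x] assms False by (simp add: add.commute)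
  qed
qed (use assms in auto)

lemma nonunits_sum: "(\<And>i. i \<in> I \<Longrightarrow> f i \<in> nonunits) \<Longrightarrow> sum f I \<in> nonunits"
  by (induction I rule: infinite_finite_induct) (auto simp: zero_nonunit nonunits_add)

lemma unit_add_nonunit:
  assumes "x \<in> units" "y \<in> nonunits"
  shows "x + y \<in> units"
proof (rule ccontr)
  assume "x + y \<notin> units"
  hence "x + y \<in> nonunits" using assms add_mem by (auto simp: nonunits_def units_def)
  moreover have "y * (- 1) \<in> nonunits" using assms one_mem uminus_mem by (intro nonunits_mult)
  ultimately have "(x + y) + y * (- 1) \<in> nonunits" by (rule nonunits_add)
  thus False using assms by (simp add: nonunits_def)
qed

text \<open>The values are pairwise distinct, so some term \<open>y k\<close> has the least one, and
  dividing the sum by it gives 1 plus nonunits, which is a unit.\<close>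

lemma sum_nonzero_of_dominant:
  assumes "finite J" "J \<noteq> {}" "\<And>i. i \<in> J \<Longrightarrow> y i \<noteq> 0"
    and "\<And>i j. i \<in> J \<Longrightarrow> j \<in> J \<Longrightarrow> i \<noteq> j \<Longrightarrow> y i / y j \<in> nonunits \<or> y j / y i \<in> nonunits"
  shows "sum y J \<noteq> 0"
proof -
  have "\<exists>k\<in>J. \<forall>j\<in>J - {k}. y j / y k \<in> nonunits"
    using assms
  proof (induction J rule: finite_ne_induct)
    case (insert i J)
    then obtain k where k: "k \<in> J" "\<forall>j\<in>J - {k}. y j / y k \<in> nonunits" by (metis insertCI)
    hence neq: "y k \<noteq> 0" "i \<noteq> k" using insert by auto
    show ?case
    proof (cases "y i / y k \<in> nonunits")
      case True
      then show ?thesis using k by blast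
    next
      case False
      hence ki: "y k / y i \<in> nonunits" using insert.prems(2)[of i k] k neq by auto
      have "y j / y i \<in> nonunits" if "j \<in> J" for j
      proof (cases "j = k")
        case False
        have "(y k / y i) * (y j / y k) \<in> nonunits"
          using ki k that False nonunit_mem by (intro nonunits_mult) auto
        thus ?thesis using neq by simp
      qed (use ki in simp)
      thus ?thesis by blast
    qed
  qed auto
  then obtain k where k: "k \<in> J" "\<forall>j\<in>J - {k}. y j / y k \<in> nonunits" by blast
  have "sum y J / y k = (\<Sum>j\<in>J. y j / y k)" by (simp add: sum_divide_distrib)
  also have "\<dots> = 1 + (\<Sum>j\<in>J - {k}. y j / y k)"
    using assms(1,3) k(1) by (subst sum.remove[of J k]) auto
  finally have "sum y J / y k \<in> units"
    using unit_add_nonunit[OF one_unit nonunits_sum] k(2) by metis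
  thus ?thesis using unit_mem by fastforce
qed

end

section \<open>Bounded rank makes a valuation ring discrete\<close>

locale bounded_rank_valuation_ring = valuation_ring +
  fixes F :: "'a set" and u :: 'a and n :: nat
  assumes base_subset: "F \<subseteq> A" and base_inverse: "a \<in> F \<Longrightarrow> inverse a \<in> F"
    and u_nonunit: "u \<in> nonunits" and u_nonzero: "u \<noteq> 0"
    and bounded_rank: "bounded_rank F u n"
begin

text \<open>After a power of \<open>u\<close> is split off, the constant coefficient is nonzero,
  hence a unit because \<open>F\<close> is closed under inverses, and the other terms add a multiple
  of the nonunit \<open>u\<close>.\<close>

lemma poly_u_eq:
  assumes "f \<in> poly_over F" "f \<noteq> 0"
  shows "\<exists>e v. v \<in> units \<and> poly f u = u ^ e * v"
  using assms
proof (induction f)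
  case (pCons a p)
  have a: "a \<in> F" and p: "p \<in> poly_over F"
    using pCons.prems(1) by (auto simp: poly_over_def coeff_pCons split: nat.splits)
  show ?case
  proof (cases "a = 0")
    case True
    then obtain e v where "v \<in> units" "poly p u = u ^ e * v" using pCons p by auto
    thus ?thesis using True by (intro exI[of _ "Suc e"] exI[of _ v]) (simp add: mult_ac)
  next
    case False
    hence "a \<in> units" using a base_subset base_inverse by (auto simp: units_def)
    moreover have "poly p u \<in> A"
      using p base_subset nonunit_mem(1)[OF u_nonunit] by (intro poly_mem) (auto simp: poly_over_def)
    hence "u * poly p u \<in> nonunits" using u_nonunit by (rule nonunits_mult[rotated])
    ultimately have "poly (pCons a p) u \<in> units" by (simp add: unit_add_nonunit)
    thus ?thesis by (intro exI[of _ 0] exI[of _ "poly (pCons a p) u"]) simp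
  qed
qed simp

text \<open>In terms of values: a strictly decreasing sequence cannot have all its differences below \<open>v(u)\<close>,
  as its members would be linearly independent over \<open>F(u)\<close>.\<close>

lemma no_short_chain:
  fixes s :: "nat \<Rightarrow> 'a"
  assumes "\<And>i. s i \<noteq> 0" "\<And>i j. i < j \<Longrightarrow> s i / s j \<in> nonunits"
    and "\<And>i j. i < j \<Longrightarrow> s j * u / s i \<in> nonunits"
  shows False
proof -
  obtain f where f: "\<forall>i\<le>n. f i \<in> poly_over F" "\<exists>i\<le>n. f i \<noteq> 0" "(\<Sum>i\<le>n. poly (f i) u * s i) = 0"
    using bounded_rank unfolding bounded_rank_def by blast
  define J where "J = {i. i \<le> n \<and> f i \<noteq> 0}"
  have J: "finite J" "J \<noteq> {}" using f(2) by (auto simp: J_def)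
  have "\<forall>i\<in>J. \<exists>e v. v \<in> units \<and> poly (f i) u = u ^ e * v"
    using f(1) poly_u_eq by (auto simp: J_def)
  then obtain e v where ev: "\<And>i. i \<in> J \<Longrightarrow> v i \<in> units" "\<And>i. i \<in> J \<Longrightarrow> poly (f i) u = u ^ e i * v i"
    by metis
  have u: "u \<in> A" using u_nonunit nonunit_mem by blast
  define y where "y = (\<lambda>i. poly (f i) u * s i)"
  \<comment> \<open>In values, \<open>y i\<close> has \<open>e i * val(u) + val(s i)\<close>. Here
    \<open>val(s i)\<close> exceeds \<open>val(s j)\<close> by less than \<open>val(u)\<close>, so
    comparing \<open>e i\<close> with \<open>e j\<close> decides which term has the larger value,
    and \<open>s\<close> breaks ties.\<close>
  have lt: "y i / y j \<in> nonunits \<or> y j / y i \<in> nonunits" if ij: "i \<in> J" "j \<in> J" "i < j" for i j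
  proof (cases "e j \<le> e i")
    case True
    have "(s i / s j) * (u ^ (e i - e j) * (v i / v j)) \<in> nonunits"
      using assms(2) ij u ev unit_mem units_divide by (intro nonunits_mult mult_mem power_mem) auto
    also have "(s i / s j) * (u ^ (e i - e j) * (v i / v j)) = y i / y j"
      using True u_nonzero ij ev by (simp add: y_def power_diff mult_ac)
    finally show ?thesis by simp
  next
    case False
    have "(s j * u / s i) * (u ^ (e j - e i - 1) * (v j / v i)) \<in> nonunits"
      using assms(3) ij u ev unit_mem units_divide by (intro nonunits_mult mult_mem power_mem) auto
    also have "(s j * u / s i) * (u ^ (e j - e i - 1) * (v j / v i)) = (u * u ^ (e j - e i - 1)) * v j * s j / (v i * s i)"
      by (simp add: mult_ac)
    also have "u * u ^ (e j - e i - 1) = u ^ (e j - e i)"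
    proof -
      have "e j - e i = Suc (e j - e i - 1)" using False by simp
      thus ?thesis by (metis power_Suc)
    qed
    also have "u ^ (e j - e i) * v j * s j / (v i * s i) = y j / y i"
      using False u_nonzero ij ev by (simp add: y_def power_diff)
    finally show ?thesis by simp
  qed
  have "sum y J \<noteq> 0"
  proof (rule sum_nonzero_of_dominant[OF J])
    show "y i \<noteq> 0" if "i \<in> J" for i
      using that ev assms(1) unit_mem(2) u_nonzero by (simp add: y_def)
    show "y i / y j \<in> nonunits \<or> y j / y i \<in> nonunits" if "i \<in> J" "j \<in> J" "i \<noteq> j" for i j
      using lt[of i j] lt[of j i] that by (cases "i < j") auto
  qed
  moreover have "sum y J = (\<Sum>i\<le>n. poly (f i) u * s i)"
    unfolding y_def J_def by (rule sum.mono_neutral_left) auto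
  ultimately show False using f(3) by simp
qed

text \<open>Otherwise below every nonzero nonunit lies another of strictly smaller positive value.
  Iterating from \<open>u\<close> gives a strictly decreasing sequence of positive values starting
  at that of \<open>u\<close>, contrary to \<open>no_short_chain\<close>.\<close>

lemma exists_generator:
  "\<exists>p\<in>nonunits. p \<noteq> 0 \<and> (\<forall>y\<in>nonunits. y / p \<in> A)"
proof (rule ccontr)
  assume neg: "\<not> ?thesis"
  have "\<exists>y\<in>nonunits. y \<noteq> 0 \<and> x / y \<in> nonunits" if x: "x \<in> nonunits" "x \<noteq> 0" for x
  proof -
    obtain y where y: "y \<in> nonunits" "y / x \<notin> A" using neg x by blast
    moreover have "y \<noteq> 0" using y zero_mem by auto
    moreover have "inverse (y / x) \<in> nonunits" using y by (intro inverse_nonunit)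
    ultimately show ?thesis by (auto simp: field_simps)
  qed
  then obtain nxt where nxt: "\<And>x. x \<in> nonunits \<Longrightarrow> x \<noteq> 0 \<Longrightarrow>
      nxt x \<in> nonunits \<and> nxt x \<noteq> 0 \<and> x / nxt x \<in> nonunits" by metis
  define s where "s = (\<lambda>i. (nxt ^^ i) u)"
  have s: "s i \<in> nonunits \<and> s i \<noteq> 0" for i
    by (induction i) (auto simp: s_def u_nonunit u_nonzero nxt)
  have s_Suc: "s i / s (Suc i) \<in> nonunits" for i
    using nxt[of "s i"] s[of i] by (simp add: s_def)
  have lt: "s i / s j \<in> nonunits" if "i < j" for i j
    using that
  proof (induction rule: less_Suc_induct)
    case (2 i j k)
    have "(s i / s j) * (s j / s k) \<in> nonunits" using 2 nonunit_mem(1) by (intro nonunits_mult)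
    thus ?case using s[of j] by simp
  qed (rule s_Suc)
  show False
  proof (rule no_short_chain)
    show "s j * u / s i \<in> nonunits" if "i < j" for i j
    proof -
      \<comment> \<open>No member has larger value than \<open>u = s 0\<close>; together with
        \<open>s j\<close> being a nonunit this keeps all differences below the value of
        \<open>u\<close>.\<close>
      have "u / s i \<in> A"
        using lt[of 0 i] nonunit_mem(1) one_mem u_nonzero by (cases "i = 0") (auto simp: s_def)
      hence "s j * (u / s i) \<in> nonunits" using s by (intro nonunits_mult) auto
      thus ?thesis by simp
    qed
  qed (use s lt in auto)
qed

text \<open>In a relation among the powers of \<open>x\<close>, divide by the lowest power that
  occurs: its coefficient, a power of \<open>u\<close> times a unit, is then a multiple of
  \<open>x\<close>.\<close>

lemma dvd_power_u:
  assumes "x \<in> A" "x \<noteq> 0"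
  shows "\<exists>e. u ^ e / x \<in> A"
proof -
  obtain f where f: "\<forall>i\<le>n. f i \<in> poly_over F" "\<exists>i\<le>n. f i \<noteq> 0" "(\<Sum>i\<le>n. poly (f i) u * x ^ i) = 0"
    using bounded_rank unfolding bounded_rank_def by blast
  define k where "k = (LEAST i. i \<le> n \<and> f i \<noteq> 0)"
  have k: "k \<le> n" "f k \<noteq> 0" using LeastI_ex[of "\<lambda>i. i \<le> n \<and> f i \<noteq> 0"] f(2) by (auto simp: k_def)
  have k_min: "f i = 0" if "i < k" for i
    using not_less_Least[of i "\<lambda>i. i \<le> n \<and> f i \<noteq> 0"] that k(1) by (auto simp: k_def)
  have u: "u \<in> A" using u_nonunit nonunit_mem by blast
  have fu: "poly (f i) u \<in> A" if "i \<le> n" for i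
    using f(1) that base_subset u by (intro poly_mem) (auto simp: poly_over_def)
  define r where "r = (\<Sum>i\<in>{k<..n}. poly (f i) u * x ^ (i - Suc k))"
  have r: "r \<in> A" unfolding r_def using assms(1) fu by (intro sum_mem mult_mem power_mem) auto
  have "0 = (\<Sum>i\<in>{k..n}. poly (f i) u * x ^ i)"
    unfolding f(3)[symmetric] using k_min by (intro sum.mono_neutral_right) auto
  also have "{k..n} = insert k {k<..n}" using k(1) by auto
  also have "(\<Sum>i\<in>\<dots>. poly (f i) u * x ^ i) = poly (f k) u * x ^ k + (\<Sum>i\<in>{k<..n}. poly (f i) u * x ^ i)"
    by simp
  also have "(\<Sum>i\<in>{k<..n}. poly (f i) u * x ^ i) = x ^ Suc k * r"
    unfolding r_def sum_distrib_left
  proof (intro sum.cong refl)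
    fix i assume "i \<in> {k<..n}"
    hence "x ^ i = x ^ Suc k * x ^ (i - Suc k)" by (simp flip: power_add del: power_Suc)
    thus "poly (f i) u * x ^ i = x ^ Suc k * (poly (f i) u * x ^ (i - Suc k))" by simp
  qed
  finally have "x ^ k * (poly (f k) u + x * r) = 0" by (simp add: algebra_simps)
  hence fk: "poly (f k) u = - x * r" using assms(2) by (simp add: add_eq_0_iff)
  obtain e v where ev: "v \<in> units" "poly (f k) u = u ^ e * v" using poly_u_eq[of "f k"] f(1) k by blast
  have "u ^ e / x = - r * inverse v"
    using ev fk assms(2) unit_mem(2)[OF ev(1)] by (simp add: field_simps)
  also have "\<dots> \<in> A" using r ev(1) by (intro mult_mem uminus_mem) (auto simp: units_def)
  finally show ?thesis by blast
qed

text \<open>If every power of \<open>p\<close> divided \<open>x\<close>, it would divide some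
  \<open>u ^ e\<close> and then \<open>u\<close> itself, so the negative powers of \<open>p\<close>
  would form a sequence of the kind excluded by \<open>no_short_chain\<close>.\<close>

lemma power_not_dvd:
  assumes p: "p \<in> nonunits" "p \<noteq> 0" and x: "x \<in> A" "x \<noteq> 0"
  shows "\<exists>m. x / p ^ m \<notin> A"
proof (rule ccontr)
  assume neg: "\<nexists>m. x / p ^ m \<notin> A"
  obtain e where e: "u ^ e / x \<in> A" using dvd_power_u[OF x] by blast
  have ue: "u ^ e / p ^ m \<in> A" for m
  proof -
    have "(u ^ e / x) * (x / p ^ m) \<in> A" using e neg by (intro mult_mem) auto
    thus ?thesis using x by simp
  qed
  have pA: "p \<in> A" using p nonunit_mem by blast
  have u: "u / p ^ m \<in> A" for m
  proof (rule ccontr)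
    assume "u / p ^ m \<notin> A"
    hence "inverse (u / p ^ m) \<in> A" using inverse_nonunit nonunit_mem by blast
    hence "(p ^ m / u) ^ e \<in> A" by (intro power_mem) simp
    \<comment> \<open>Divisibility is used at one power beyond \<open>m * e\<close>, which exhibits
      1 as a multiple of the nonunit \<open>p\<close>.\<close>
    hence "p * ((p ^ m / u) ^ e * (u ^ e / p ^ Suc (m * e))) \<in> nonunits"
      using ue p by (intro nonunits_mult mult_mem)
    moreover have "p * ((p ^ m / u) ^ e * (u ^ e / p ^ Suc (m * e))) = 1"
      using p u_nonzero by (simp add: power_divide power_mult)
    ultimately show False using one_unit by (simp add: nonunits_def)
  qed
  show False
  proof (rule no_short_chain[of "\<lambda>i. inverse p ^ i"])
    fix i j :: nat assume ij: "i < j"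
    hence *: "p ^ j = p ^ i * (p * p ^ (j - i - 1))" by (simp flip: power_Suc power_add)
    have "p * p ^ (j - i - 1) \<in> nonunits" using p pA by (intro nonunits_mult power_mem)
    also have "p * p ^ (j - i - 1) = inverse p ^ i / inverse p ^ j"
      unfolding power_inverse using p * by (simp add: field_simps)
    finally show "inverse p ^ i / inverse p ^ j \<in> nonunits" .
    have "p * (u / p ^ Suc (j - i)) \<in> nonunits" using p u by (intro nonunits_mult)
    also have "p * (u / p ^ Suc (j - i)) = inverse p ^ j * u / inverse p ^ i"
      using p ij by (simp add: power_diff field_simps)
    finally show "inverse p ^ j * u / inverse p ^ i \<in> nonunits" .
  qed (use p in auto)
qed

text \<open>With a generator \<open>p\<close> of the maximal ideal, every nonzero element is a unit
  times a unique integral power of \<open>p\<close>; \<open>w\<close> is the exponent.\<close>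

lemma exists_discrete_valuation:
  "\<exists>w. discrete_valuation w \<and> w u > 0"
proof -
  obtain p where p: "p \<in> nonunits" "p \<noteq> 0" and gen: "\<And>y. y \<in> nonunits \<Longrightarrow> y / p \<in> A"
    using exists_generator by blast
  have pA: "p \<in> A" using p nonunit_mem by blast
  have ex_A: "\<exists>m::int. x / p powi m \<in> units" if x: "x \<in> A" "x \<noteq> 0" for x
  proof -
    \<comment> \<open>The first power of \<open>p\<close> that fails to divide \<open>x\<close>; the
      quotient by the previous one is a unit, since a nonunit could be divided by \<open>p\<close>
      once more.\<close>
    define m where "m = (LEAST m. x / p ^ m \<notin> A)"
    have m: "x / p ^ m \<notin> A" unfolding m_def using power_not_dvd[OF p x] by (rule LeastI_ex)
    then obtain k where k: "m = Suc k" using x(1) by (cases m) auto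
    have "x / p ^ k \<in> A" using not_less_Least[of k "\<lambda>m. x / p ^ m \<notin> A"] k by (auto simp: m_def)
    moreover have "x / p ^ k \<notin> nonunits" using gen[of "x / p ^ k"] m k by (auto simp: field_simps)
    ultimately have "x / p ^ k \<in> units" by (simp add: nonunits_def)
    thus ?thesis by (intro exI[of _ "int k"]) simp
  qed
  have ex: "\<exists>m::int. x / p powi m \<in> units" if x: "x \<noteq> 0" for x
  proof (cases "x \<in> A")
    case False
    hence "inverse x \<in> A" using mem_or_inverse_mem x by blast
    then obtain m :: int where "inverse x / p powi m \<in> units" using ex_A[of "inverse x"] x by auto
    hence "inverse (inverse x / p powi m) \<in> units" by (rule units_inverse)
    thus ?thesis using x by (intro exI[of _ "- m"]) (simp add: power_int_minus field_simps)
  qed (use ex_A x in blast)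
  have powi_mem: "p powi k \<in> A \<longleftrightarrow> k \<ge> 0" for k
  proof
    show "p powi k \<in> A" if "k \<ge> 0" using that pA by (simp add: power_int_nonneg_exp power_mem)
    show "k \<ge> 0" if "p powi k \<in> A"
    proof (rule ccontr)
      assume "\<not> k \<ge> 0"
      hence "p powi k * p ^ nat (- k - 1) = inverse p"
        using p(2) by (simp flip: power_int_of_nat power_int_add power_int_minus)
      hence "inverse p \<in> A" using that pA by (metis mult_mem power_mem)
      thus False using p pA by (simp add: nonunits_def units_def)
    qed
  qed
  define w where "w = (\<lambda>x. SOME m. x / p powi m \<in> units)"
  have w: "x / p powi w x \<in> units" if "x \<noteq> 0" for x
    unfolding w_def using someI_ex[OF ex[OF that]] .
  \<comment> \<open>This turns the inequality for \<open>w (x + y)\<close> into closure of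
    \<open>A\<close> under addition.\<close>
  have w_ge: "m \<le> w x \<longleftrightarrow> x / p powi m \<in> A" if x: "x \<noteq> 0" for m x
  proof -
    have "x / p powi m = (x / p powi w x) * p powi (w x - m)"
      using p by (simp add: power_int_diff)
    moreover have "p powi (w x - m) = inverse (x / p powi w x) * (x / p powi m)"
      using p x by (simp add: power_int_diff)
    moreover have "x / p powi w x \<in> A" "inverse (x / p powi w x) \<in> A"
      using w[OF x] by (auto simp: units_def)
    ultimately have "x / p powi m \<in> A \<longleftrightarrow> p powi (w x - m) \<in> A" by (metis mult_mem)
    thus ?thesis by (simp add: powi_mem)
  qed
  have w_eq: "w x = m" if "x / p powi m \<in> units" for x m
  proof -
    have x: "x \<noteq> 0" using that unit_mem(2) by fastforce
    have "(x / p powi m) / (x / p powi w x) \<in> units" using that w[OF x] by (rule units_divide)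
    hence *: "p powi (w x - m) \<in> units" using p x by (simp add: power_int_diff)
    have "inverse (p powi (w x - m)) = p powi (- (w x - m))" by (rule power_int_minus[symmetric])
    hence "p powi (w x - m) \<in> A" "p powi (- (w x - m)) \<in> A"
      using * by (auto simp: units_def)
    thus ?thesis unfolding powi_mem by simp
  qed
  have "discrete_valuation w"
    unfolding discrete_valuation_def
  proof (intro conjI allI impI)
    fix x y :: 'a assume xy: "x \<noteq> 0" "y \<noteq> 0"
    have "(x / p powi w x) * (y / p powi w y) \<in> units" using w xy by (intro units_mult) auto
    thus "w (x * y) = w x + w y" using p by (intro w_eq) (simp add: power_int_add)
    assume "x + y \<noteq> 0"
    moreover have "x / p powi min (w x) (w y) + y / p powi min (w x) (w y) \<in> A"
      using xy by (intro add_mem) (auto simp flip: w_ge)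
    ultimately show "min (w x) (w y) \<le> w (x + y)" by (simp add: w_ge add_divide_distrib)
  next
    fix m :: int
    have "w (p powi m) = m" using p one_unit by (intro w_eq) simp
    thus "\<exists>x. x \<noteq> 0 \<and> w x = m" using p by (metis power_int_not_zero)
  qed
  moreover have "w u \<ge> 1" using gen[OF u_nonunit] u_nonzero by (simp add: w_ge)
  ultimately show ?thesis by (intro exI[of _ w]) auto
qed

end

section \<open>Constants and units of a function field\<close>

lemma coeff_sum_monom: "coeff (\<Sum>j\<le>m. monom (c j) j) k = (if k \<le> m then c k else 0)"
  by (simp add: coeff_sum)

lemma (in field_subring) not_transcendental_of_finite:
  fixes t :: 'a
  assumes "CHAR('a) > 0" "finite A" "t \<in> A"
  shows "\<not> transcendental_over_prime t"
proof
  assume t: "transcendental_over_prime t"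
  interpret F: field_subring "prime_subfield :: 'a set"
    unfolding prime_subfield_eq[OF assms(1)] by (rule field_subring_range_of_int)
  have "\<not> inj (\<lambda>n. t ^ n)"
    using finite_subset[of "range (\<lambda>n. t ^ n)" A] assms power_mem finite_imageD by blast
  then obtain a b where ab: "t ^ a = t ^ b" "a \<noteq> b" unfolding inj_def by blast
  have "monom 1 a - monom 1 b \<in> poly_over (prime_subfield :: 'a set)"
    by (intro F.poly_over_diff F.poly_over_monom F.one_mem)
  moreover have "poly (monom 1 a - monom 1 b) t = 0" using ab by (simp add: poly_monom)
  ultimately have "monom 1 a - monom 1 b = (0 :: 'a poly)"
    using t by (auto simp: transcendental_over_prime_def)
  hence "coeff (monom 1 a - monom 1 b :: 'a poly) a = 0" by (simp only: coeff_0)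
  thus False using ab by simp
qed

section \<open>Finite rank over \<open>F(u)\<close> and finiteness of the constants\<close>

locale function_field =
  fixes t :: "'a::field" and B :: "'a set"
  assumes prime_char: "prime CHAR('a)"
    and transcendental: "transcendental_over_prime t"
    and finite_B: "finite B"
    and spanning: "\<exists>c. (\<forall>b\<in>B. c b \<in> rat_fun_subfield t) \<and> x = (\<Sum>b\<in>B. c b * b)"
begin

abbreviation F :: "'a set" where "F \<equiv> prime_subfield"

lemma char_pos: "CHAR('a) > 0"
  using prime_char prime_gt_0_nat by blast

lemma finite_F: "finite F"
  unfolding prime_subfield_eq[OF char_pos] by (rule finite_range_of_int[OF char_pos])

sublocale F: field_subring F
  unfolding prime_subfield_eq[OF char_pos] by (rule field_subring_range_of_int)

lemma clear_denominators:
  fixes x :: "nat \<Rightarrow> 'a"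
  obtains D a where "D \<noteq> 0" "\<And>i b. i \<le> n \<Longrightarrow> b \<in> B \<Longrightarrow> a i b \<in> adjoin F t"
    "\<And>i. D * x i = (\<Sum>b\<in>B. a i b * b)"
proof -
  interpret T: field_subring "adjoin F t" by (rule F.field_subring_adjoin)
  have "\<forall>i. \<exists>c. (\<forall>b\<in>B. c b \<in> rat_fun_subfield t) \<and> x i = (\<Sum>b\<in>B. c b * b)"
    using spanning by blast
  from choice[OF this] obtain c where c: "\<And>i b. b \<in> B \<Longrightarrow> c i b \<in> rat_fun_subfield t"
    "\<And>i. x i = (\<Sum>b\<in>B. c i b * b)" by blast
  have den: "\<exists>d\<in>adjoin F t. d \<noteq> 0 \<and> d * z \<in> adjoin F t" if z: "z \<in> rat_fun_subfield t" for z
  proof -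
    obtain f g where fg: "f \<in> poly_over F" "g \<in> poly_over F" "z = poly f t / poly g t"
      using z by (auto simp: rat_fun_subfield_def)
    show ?thesis
    proof (cases "poly g t = 0")
      \<comment> \<open>A vanishing denominator makes \<open>z = 0\<close>, division by zero being
        0, so 1 clears it.\<close>
      case True
      then show ?thesis using fg(3) T.one_mem T.zero_mem by (intro bexI[of _ 1]) auto
    next
      case False
      then show ?thesis using fg F.poly_mem_adjoin by (intro bexI[of _ "poly g t"]) auto
    qed
  qed
  let ?X = "(\<lambda>(i, b). c i b) ` ({..n} \<times> B)"
  have "\<exists>D\<in>adjoin F t. D \<noteq> 0 \<and> (\<forall>z\<in>?X. D * z \<in> adjoin F t)"
    using finite_B c(1) by (intro T.common_denominator) (auto intro!: den T.mult_mem)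
  then obtain D where D: "D \<noteq> 0" "\<And>i b. i \<le> n \<Longrightarrow> b \<in> B \<Longrightarrow> D * c i b \<in> adjoin F t"
    by auto
  show thesis
    using D by (intro that[of D "\<lambda>i b. D * c i b"]) (auto simp: c(2) sum_distrib_left mult_ac)
qed

lemma bounded_rank_of_relation:
  assumes "\<And>x :: nat \<Rightarrow> 'a. \<exists>c. (\<forall>i\<in>{..n}. c i \<in> adjoin F u) \<and> (\<exists>i\<in>{..n}. c i \<noteq> 0) \<and>
     (\<Sum>i\<in>{..n}. c i * x i) = 0"
  shows "bounded_rank F u n"
  unfolding bounded_rank_def
proof
  fix x :: "nat \<Rightarrow> 'a"
  obtain c where c: "\<forall>i\<in>{..n}. c i \<in> adjoin F u" "\<exists>i\<in>{..n}. c i \<noteq> 0" "(\<Sum>i\<in>{..n}. c i * x i) = 0"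
    using assms by blast
  have "\<forall>i\<in>{..n}. \<exists>f. f \<in> poly_over F \<and> c i = poly f u" using c(1) by (auto simp: adjoin_def)
  then obtain f where f: "\<And>i. i \<le> n \<Longrightarrow> f i \<in> poly_over F" "\<And>i. i \<le> n \<Longrightarrow> c i = poly (f i) u"
    by (metis atMost_iff)
  show "\<exists>f. (\<forall>i\<le>n. f i \<in> poly_over F) \<and> (\<exists>i\<le>n. f i \<noteq> 0) \<and> (\<Sum>i\<le>n. poly (f i) u * x i) = 0"
  proof (intro exI[of _ f] conjI)
    obtain i where "i \<le> n" "c i \<noteq> 0" using c(2) by auto
    thus "\<exists>i\<le>n. f i \<noteq> 0" using f(2)[of i] by (intro exI[of _ i]) auto
    have "(\<Sum>i\<le>n. poly (f i) u * x i) = (\<Sum>i\<in>{..n}. c i * x i)"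
      using f(2) by (intro sum.cong) auto
    thus "(\<Sum>i\<le>n. poly (f i) u * x i) = 0" using c(3) by simp
  qed (use f(1) in blast)
qed

lemma bounded_rank_t: "bounded_rank F t (card B)"
proof (rule bounded_rank_of_relation)
  fix x :: "nat \<Rightarrow> 'a"
  interpret T: field_subring "adjoin F t" by (rule F.field_subring_adjoin)
  obtain D a where "D \<noteq> 0" "\<And>i b. i \<le> card B \<Longrightarrow> b \<in> B \<Longrightarrow> a i b \<in> adjoin F t"
    "\<And>i. D * x i = (\<Sum>b\<in>B. a i b * b)"
    using clear_denominators[where x = x and n = "card B"] by blast
  thus "\<exists>c. (\<forall>i\<in>{..card B}. c i \<in> adjoin F t) \<and> (\<exists>i\<in>{..card B}. c i \<noteq> 0) \<and>
     (\<Sum>i\<in>{..card B}. c i * x i) = 0"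
    using finite_B
    by (intro T.linear_relation_of_span[where B = B and a = a and D = D and y = "\<lambda>b. b"]) auto
qed

text \<open>The powers of \<open>u\<close> up to \<open>card B\<close> are dependent over
  \<open>F[t]\<close>; their relation is reordered by powers of \<open>t\<close>. The resulting
  bound on the degrees in \<open>u\<close> does not depend on \<open>u\<close>.\<close>

lemma relation_with_t:
  obtains g m where "\<And>j. g j \<in> poly_over F" "\<And>j. degree (g j) \<le> card B" "\<exists>j\<le>m. g j \<noteq> 0"
    "(\<Sum>j\<le>m. poly (g j) u * t ^ j) = 0"
proof -
  obtain f where f: "\<forall>i\<le>card B. f i \<in> poly_over F" "\<exists>i\<le>card B. f i \<noteq> 0"
    "(\<Sum>i\<le>card B. poly (f i) t * u ^ i) = 0"
    using bounded_rank_t unfolding bounded_rank_def by blast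
  obtain g m where "\<And>j. g j \<in> poly_over F" "\<And>j. degree (g j) \<le> card B" "\<exists>j\<le>m. g j \<noteq> 0"
    "\<And>a b. (\<Sum>i\<le>card B. poly (f i) a * b ^ i) = (\<Sum>j\<le>m. poly (g j) b * a ^ j)"
    using F.swap_variables[of "card B" f] f by blast
  with that[of g m] f(3) show thesis by simp
qed

lemma algebraic_over_adjoin:
  assumes "\<And>j. g j \<in> poly_over F" "j \<le> m" "poly (g j) u \<noteq> 0" "(\<Sum>j\<le>m. poly (g j) u * t ^ j) = 0"
  obtains Q where "Q \<in> poly_over (adjoin F u)" "Q \<noteq> 0" "poly Q t = 0"
proof -
  interpret U: field_subring "adjoin F u" by (rule F.field_subring_adjoin)
  define Q where "Q = (\<Sum>j\<le>m. monom (poly (g j) u) j)"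
  have "Q \<in> poly_over (adjoin F u)" unfolding Q_def
    using assms(1) by (intro U.poly_over_sum U.poly_over_monom F.poly_mem_adjoin)
  moreover have "coeff Q j \<noteq> 0" using assms(2,3) by (simp add: Q_def coeff_sum_monom)
  hence "Q \<noteq> 0" by auto
  moreover have "poly Q t = 0" using assms(4) by (simp add: Q_def poly_sum poly_monom)
  ultimately show thesis using that by blast
qed

text \<open>Constants have degree at most \<open>[K : F(t)]\<close> over the prime field.\<close>

lemma finite_constant_field: "finite (constant_field :: 'a set)"
proof (rule finite_subset)
  let ?G = "{g \<in> poly_over F. \<forall>i\<ge>Suc (card B). coeff g i = 0}"
  show "(constant_field :: 'a set) \<subseteq> (\<Union>g\<in>?G - {0}. {x. poly g x = 0})"
  proof
    fix c :: 'a assume "c \<in> constant_field"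
    then obtain f where f: "f \<in> poly_over F" "f \<noteq> 0" "poly f c = 0"
      by (auto simp: constant_field_def)
    have fin: "finite (adjoin F c)" by (rule F.finite_adjoin[OF finite_F f])
    interpret C: field_subring "adjoin F c" by (rule F.field_subring_adjoin)
    obtain g m where g: "\<And>j. g j \<in> poly_over F" "\<And>j. degree (g j) \<le> card B" "\<exists>j\<le>m. g j \<noteq> 0"
      "(\<Sum>j\<le>m. poly (g j) c * t ^ j) = 0" using relation_with_t[of c] by blast
    then obtain j where j: "j \<le> m" "g j \<noteq> 0" by blast
    \<comment> \<open>Otherwise \<open>t\<close> would be algebraic over the finite ring
      \<open>F[c]\<close>, and adjoining it would give a finite ring containing the transcendental
      \<open>t\<close>.\<close>
    have "poly (g j) c = 0"
    proof (rule ccontr)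
      assume "poly (g j) c \<noteq> 0"
      then obtain Q where "Q \<in> poly_over (adjoin F c)" "Q \<noteq> 0" "poly Q t = 0"
        using algebraic_over_adjoin[OF g(1) j(1) _ g(4)] by blast
      hence "finite (adjoin (adjoin F c) t)" by (rule C.finite_adjoin[OF fin])
      from field_subring.not_transcendental_of_finite[OF C.field_subring_adjoin char_pos this C.gen_mem_adjoin]
      show False using transcendental by contradiction
    qed
    moreover have "coeff (g j) i = 0" if "i \<ge> Suc (card B)" for i
      using g(2)[of j] that by (intro coeff_eq_0) simp
    hence "g j \<in> ?G - {0}" using g(1) j(2) by blast
    ultimately show "c \<in> (\<Union>g\<in>?G - {0}. {x. poly g x = 0})" by (intro UN_I[of "g j"]) simp_all
  qed
  show "finite (\<Union>g\<in>?G - {0}. {x. poly g x = 0})"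
    using F.finite_poly_over_bounded[OF finite_F] by (intro finite_UN_I) (auto intro: poly_roots_finite)
qed

text \<open>Since \<open>t\<close> is algebraic over \<open>F[u]\<close> with equation
  \<open>Q\<close>, the products \<open>b * t ^ k\<close> with \<open>b \<in> B\<close> and
  \<open>k < degree Q\<close> span the field over \<open>F(u)\<close>; their number is the
  bound.\<close>

lemma bounded_rank_transcendental:
  fixes u :: 'a
  assumes "transcendental_over_prime u"
  shows "\<exists>n. bounded_rank F u n"
proof -
  interpret U: field_subring "adjoin F u" by (rule F.field_subring_adjoin)
  obtain g m where g: "\<And>j. g j \<in> poly_over F" "\<exists>j\<le>m. g j \<noteq> 0"
    "(\<Sum>j\<le>m. poly (g j) u * t ^ j) = 0" using relation_with_t[of u] by metis
  then obtain j where j: "j \<le> m" "g j \<noteq> 0" by blast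
  have "poly (g j) u \<noteq> 0" using assms g(1) j by (auto simp: transcendental_over_prime_def)
  then obtain Q where Q: "Q \<in> poly_over (adjoin F u)" "Q \<noteq> 0" "poly Q t = 0"
    using algebraic_over_adjoin[OF g(1) j(1) _ g(3)] by blast
  let ?k = "degree Q"
  \<comment> \<open>The \<open>F[u]\<close>-module generated by the powers of \<open>t\<close> below
    \<open>degree Q\<close>; every element of \<open>F[t]\<close> enters it after multiplication by
    a power of the leading coefficient of \<open>Q\<close>.\<close>
  define M where "M = (\<lambda>r. poly r t) ` {r \<in> poly_over (adjoin F u). \<forall>i\<ge>?k. coeff r i = 0}"
  let ?n = "card (B \<times> {..<?k})"
  have "bounded_rank F u ?n"
  proof (rule bounded_rank_of_relation)
    fix x :: "nat \<Rightarrow> 'a"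
    obtain D a where D: "D \<noteq> 0" "\<And>i b. i \<le> ?n \<Longrightarrow> b \<in> B \<Longrightarrow> a i b \<in> adjoin F t"
      "\<And>i. D * x i = (\<Sum>b\<in>B. a i b * b)"
      using clear_denominators[where x = x and n = ?n] by blast
    have den: "\<exists>d\<in>adjoin F u. d \<noteq> 0 \<and> d * z \<in> M" if z: "z \<in> adjoin F t" for z
    proof -
      obtain f where f: "f \<in> poly_over F" "z = poly f t" using z by (auto simp: adjoin_def)
      have "f \<in> poly_over (adjoin F u)" using f F.subset_adjoin by (auto simp: poly_over_def)
      from U.reduce_at_root[OF Q(1,3) this] obtain e r where
        "r \<in> poly_over (adjoin F u)" "\<forall>i\<ge>?k. coeff r i = 0" "lead_coeff Q ^ e * z = poly r t"
        using f by blast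
      hence "lead_coeff Q ^ e * z \<in> M" by (auto simp: M_def)
      moreover have "lead_coeff Q ^ e \<in> adjoin F u"
        using Q(1) by (intro U.power_mem) (auto simp: poly_over_def)
      ultimately show ?thesis using Q(2) by (intro bexI[of _ "lead_coeff Q ^ e"]) auto
    qed
    let ?X = "(\<lambda>(i, b). a i b) ` ({..?n} \<times> B)"
    have "\<exists>E\<in>adjoin F u. E \<noteq> 0 \<and> (\<forall>z\<in>?X. E * z \<in> M)"
    proof (rule U.common_denominator)
      show "\<exists>d\<in>adjoin F u. d \<noteq> 0 \<and> d * z \<in> M" if "z \<in> ?X" for z
        using that D(2) by (intro den) auto
      show "e * y \<in> M" if e: "e \<in> adjoin F u" and y: "y \<in> M" for e y
      proof -
        obtain r where r: "r \<in> poly_over (adjoin F u)" "\<forall>i\<ge>?k. coeff r i = 0" "y = poly r t"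
          using y by (auto simp: M_def)
        hence "e * y = poly (smult e r) t" by simp
        thus ?thesis
          unfolding M_def using r e by (intro image_eqI[of _ _ "smult e r"]) (auto intro: U.poly_over_smult)
      qed
    qed (use finite_B in auto)
    then obtain E where E: "E \<noteq> 0" "\<And>i b. i \<le> ?n \<Longrightarrow> b \<in> B \<Longrightarrow> E * a i b \<in> M"
      by auto
    have "\<forall>i b. \<exists>r. i \<le> ?n \<and> b \<in> B \<longrightarrow> r \<in> poly_over (adjoin F u) \<and> (\<forall>i\<ge>?k. coeff r i = 0) \<and> E * a i b = poly r t"
      using E(2) unfolding M_def by blast
    then obtain r where r: "\<And>i b. i \<le> ?n \<Longrightarrow> b \<in> B \<Longrightarrow>
      r i b \<in> poly_over (adjoin F u) \<and> (\<forall>j\<ge>?k. coeff (r i b) j = 0) \<and> E * a i b = poly (r i b) t"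
      by metis
    \<comment> \<open>\<open>D\<close> clears the denominators over \<open>F[t]\<close> and
      \<open>E\<close> those that arise on reducing modulo \<open>Q\<close>.\<close>
    have eq: "(E * D) * x i = (\<Sum>p\<in>B \<times> {..<?k}. coeff (r i (fst p)) (snd p) * (t ^ snd p * fst p))"
      if i: "i \<le> ?n" for i
    proof -
      have pr: "poly (r i b) t = (\<Sum>k<?k. coeff (r i b) k * t ^ k)" if "b \<in> B" for b
        unfolding poly_altdef
      proof (rule sum.mono_neutral_cong)
        show "coeff (r i b) k * t ^ k = 0" if "k \<in> {..<?k} - {..degree (r i b)}" for k
          using that by (simp add: coeff_eq_0)
        show "coeff (r i b) k * t ^ k = 0" if "k \<in> {..degree (r i b)} - {..<?k}" for k
          using that r[OF i \<open>b \<in> B\<close>] by simp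
      qed auto
      have "(E * D) * x i = (\<Sum>b\<in>B. (E * a i b) * b)"
        by (simp add: mult.assoc D(3) sum_distrib_left)
      also have "\<dots> = (\<Sum>b\<in>B. \<Sum>k<?k. coeff (r i b) k * (t ^ k * b))"
        using r[OF i] pr by (intro sum.cong refl) (simp add: sum_distrib_right mult.assoc)
      finally show ?thesis by (simp add: sum.cartesian_product case_prod_unfold)
    qed
    show "\<exists>c. (\<forall>i\<in>{..?n}. c i \<in> adjoin F u) \<and> (\<exists>i\<in>{..?n}. c i \<noteq> 0) \<and> (\<Sum>i\<in>{..?n}. c i * x i) = 0"
    proof (rule U.linear_relation_of_span[OF _ _ _ _ _ eq])
      show "coeff (r i (fst p)) (snd p) \<in> adjoin F u" if "i \<in> {..?n}" "p \<in> B \<times> {..<?k}" for i p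
        using r[of i "fst p"] that by (auto simp: poly_over_def)
    qed (use finite_B E D in auto)
  qed
  thus ?thesis by blast
qed

text \<open>\<open>inverse u\<close> is not in \<open>F[u]\<close>, so some valuation ring contains
  \<open>u\<close> as a nonunit; finite rank over \<open>F(u)\<close> makes it discrete, and its
  valuation is positive at \<open>u\<close>.\<close>

lemma exists_zero_of_transcendental:
  fixes u :: 'a
  assumes u: "transcendental_over_prime u"
  shows "\<exists>w. discrete_valuation w \<and> w u > 0"
proof -
  interpret U: field_subring "adjoin F u" by (rule F.field_subring_adjoin)
  have nz: "poly f u \<noteq> 0" if "f \<in> poly_over F" "f \<noteq> 0" for f
    using u that by (auto simp: transcendental_over_prime_def)
  have u0: "u \<noteq> 0" using nz[of "[:0, 1:]"] by (auto simp: F.poly_over_pCons F.poly_over_0 F.zero_mem F.one_mem)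
  have "inverse u \<notin> adjoin F u"
  proof
    assume "inverse u \<in> adjoin F u"
    then obtain f where f: "f \<in> poly_over F" "inverse u = poly f u" by (auto simp: adjoin_def)
    \<comment> \<open>The relation \<open>u * f(u) = 1\<close> makes \<open>u\<close> a root of
      \<open>X * f - 1\<close>, which is \<open>pCons (- 1) f\<close>.\<close>
    hence "poly (pCons (- 1) f) u = 0" using u0 by (simp flip: f(2))
    moreover have "pCons (- 1) f \<in> poly_over F" using f(1) F.uminus_mem[OF F.one_mem] by (simp add: F.poly_over_pCons)
    ultimately show False using nz[of "pCons (- 1) f"] by auto
  qed
  then obtain V where V: "valuation_ring V" "adjoin F u \<subseteq> V" "inverse u \<notin> V"
    using exists_valuation_ring[OF U.field_subring_axioms F.gen_mem_adjoin] by blast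
  obtain n where n: "bounded_rank F u n" using bounded_rank_transcendental[OF u] by blast
  interpret valuation_ring V by fact
  interpret bounded_rank_valuation_ring V F u n
  proof
    show "F \<subseteq> V" using F.subset_adjoin V(2) by blast
    show "inverse a \<in> F" if "a \<in> F" for a using F.inverse_mem_of_finite[OF finite_F that] .
    show "u \<in> nonunits" using V F.gen_mem_adjoin by (auto simp: nonunits_def units_def)
  qed (use u0 n in auto)
  show ?thesis by (rule exists_discrete_valuation)
qed

lemma transcendental_inverse:
  fixes u :: 'a
  assumes "transcendental_over_prime u" "u \<noteq> 0"
  shows "transcendental_over_prime (inverse u)"
  unfolding transcendental_over_prime_def
proof (intro ballI impI)
  fix f assume f: "f \<in> poly_over F" "poly f (inverse u) = 0"
  have "reflect_poly f \<in> poly_over F" using f(1) F.zero_mem by (auto simp: poly_over_def coeff_reflect_poly)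
  moreover have "poly (reflect_poly f) u = 0" using f(2) assms(2) by (simp add: poly_reflect_poly_nz)
  ultimately show "f = 0" using assms(1) by (auto simp: transcendental_over_prime_def)
qed

lemma unit_away_from_constant:
  fixes u :: 'a
  assumes "u \<noteq> 0" "u \<in> ring_away_from vinf" "inverse u \<in> ring_away_from vinf"
  shows "u \<in> constant_field"
proof (rule ccontr)
  assume "u \<notin> constant_field"
  hence u: "transcendental_over_prime u"
    by (auto simp: constant_field_def transcendental_over_prime_def)
  obtain w where w: "discrete_valuation w" "w u > 0" using exists_zero_of_transcendental[OF u] by blast
  obtain w' where w': "discrete_valuation w'" "w' (inverse u) > 0"
    using exists_zero_of_transcendental[OF transcendental_inverse[OF u assms(1)]] by blast
  have inv: "v u + v (inverse u) = 0" if "discrete_valuation v" for v :: "'a \<Rightarrow> int"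
  proof -
    have mult: "v (x * y) = v x + v y" if "x \<noteq> 0" "y \<noteq> 0" for x y
      using that \<open>discrete_valuation v\<close> by (simp add: discrete_valuation_def)
    show ?thesis using mult[of u "inverse u"] mult[of 1 1] assms(1) by simp
  qed
  \<comment> \<open>A zero of \<open>u\<close> is a pole of \<open>inverse u\<close>, and elements
    of the ring have poles only at \<open>vinf\<close>; the same argument with \<open>u\<close> and
    \<open>inverse u\<close> exchanged puts the pole of \<open>u\<close> there too.\<close>
  have "same_prime w vinf"
    using assms(1,3) w inv[OF w(1)] by (fastforce simp: ring_away_from_def)
  moreover have "same_prime w' vinf"
    using assms(1,2) w' inv[OF w'(1)] by (fastforce simp: ring_away_from_def)
  ultimately have "w u = w' u" using assms(1) by (simp add: same_prime_def)
  thus False using w w' inv[OF w'(1)] by simp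
qed

end

section \<open>Periodic points\<close>

locale discrete_valued_field =
  fixes w :: "'a::field \<Rightarrow> int"
  assumes valuation: "discrete_valuation w"
begin

lemma val_mult: "x \<noteq> 0 \<Longrightarrow> y \<noteq> 0 \<Longrightarrow> w (x * y) = w x + w y"
  using valuation by (simp add: discrete_valuation_def)

lemma val_add: "x \<noteq> 0 \<Longrightarrow> y \<noteq> 0 \<Longrightarrow> x + y \<noteq> 0 \<Longrightarrow> min (w x) (w y) \<le> w (x + y)"
  using valuation by (simp add: discrete_valuation_def)

lemma val_1: "w 1 = 0"
  using val_mult[of 1 1] by simp

lemma val_minus: "w (- x) = w x"
proof (cases "x = 0")
  case False
  have "w (- 1) = 0" using val_mult[of "- 1" "- 1"] val_1 by simp
  thus ?thesis using val_mult[of "- 1" x] False by simp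
qed simp

lemma val_power: "x \<noteq> 0 \<Longrightarrow> w (x ^ n) = int n * w x"
  by (induction n) (auto simp: val_1 val_mult algebra_simps)

text \<open>\<open>w 0\<close> is arbitrary, so a vanishing term or sum is a case of its
  own.\<close>

lemma val_sum:
  assumes "\<And>i. i \<in> I \<Longrightarrow> f i = 0 \<or> c \<le> w (f i)"
  shows "sum f I = 0 \<or> c \<le> w (sum f I)"
  using assms
proof (induction I rule: infinite_finite_induct)
  case (insert i I)
  hence "f i = 0 \<or> c \<le> w (f i)" "sum f I = 0 \<or> c \<le> w (sum f I)" by auto
  thus ?case using insert(1,2) val_add[of "f i" "sum f I"] by fastforce
qed auto

lemma field_subring_integers: "field_subring {x. x = 0 \<or> w x \<ge> 0}"
proof
  fix x y assume xy: "x \<in> {x. x = 0 \<or> w x \<ge> 0}" "y \<in> {x. x = 0 \<or> w x \<ge> 0}"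
  show "x - y \<in> {x. x = 0 \<or> w x \<ge> 0}"
  proof (cases "x = 0 \<or> y = 0 \<or> x - y = 0")
    case True
    then show ?thesis using xy by (auto simp: val_minus)
  next
    case False
    then show ?thesis using xy val_add[of x "- y"] by (auto simp: val_minus)
  qed
  show "x * y \<in> {x. x = 0 \<or> w x \<ge> 0}"
    using xy by (cases "x = 0 \<or> y = 0") (auto simp: val_mult)
qed (simp add: val_1)

text \<open>With \<open>d = degree f\<close>, the leading term has value \<open>d * w x\<close>,
  strictly below the bound \<open>(d - 1) * w x\<close> for all lower terms because
  \<open>w x < 0\<close>, so it alone determines the value; \<open>d \<ge> 2\<close> makes this
  smaller than \<open>w x\<close>.\<close>

lemma val_poly_less:
  assumes "\<And>i. coeff f i = 0 \<or> w (coeff f i) \<ge> 0" "w (lead_coeff f) = 0" "degree f \<ge> 2"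
    and x: "x \<noteq> 0" "w x < 0"
  shows "poly f x \<noteq> 0 \<and> w (poly f x) < w x"
proof -
  let ?d = "degree f"
  define S where "S = (\<Sum>i<?d. coeff f i * x ^ i)"
  define T where "T = lead_coeff f * x ^ ?d"
  have lead: "lead_coeff f \<noteq> 0" using assms(3) by auto
  have T: "T \<noteq> 0" "w T = int ?d * w x"
    using assms(2) lead x by (auto simp: T_def val_mult val_power)
  have eq: "poly f x = S + T"
    by (simp add: poly_altdef S_def T_def atMost_Suc_eq_insert_0 flip: lessThan_Suc_atMost)
  have S: "S = 0 \<or> (int ?d - 1) * w x \<le> w S"
    unfolding S_def
  proof (rule val_sum)
    fix i assume i: "i \<in> {..<?d}"
    show "coeff f i * x ^ i = 0 \<or> (int ?d - 1) * w x \<le> w (coeff f i * x ^ i)"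
    proof (cases "coeff f i = 0")
      case False
      have "(int ?d - 1) * w x \<le> int i * w x" using i x by (intro mult_right_mono_neg) auto
      moreover have "w (coeff f i * x ^ i) = w (coeff f i) + int i * w x"
        using False x by (simp add: val_mult val_power)
      ultimately show ?thesis using False assms(1)[of i] by linarith
    qed simp
  qed
  have less: "int ?d * w x < (int ?d - 1) * w x" using x by (simp add: algebra_simps)
  have d: "int ?d * w x < w x"
  proof -
    have "int ?d * w x \<le> 2 * w x" using assms(3) x by (intro mult_right_mono_neg) auto
    thus ?thesis using x by simp
  qed
  show ?thesis
  proof (cases "S = 0")
    case True
    then show ?thesis using T d eq by simp
  next
    case False
    hence wS: "w T < w S" using S T less by simp
    have "S + T \<noteq> 0"
    proof
      assume "S + T = 0"
      hence "S = - T" by (simp add: add_eq_0_iff2)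
      thus False using wS by (simp add: val_minus)
    qed
    moreover from this have "min (w (S + T)) (w (- S)) \<le> w T"
      using val_add[of "S + T" "- S"] False T by simp
    hence "w (S + T) \<le> w T" using wS by (simp add: val_minus)
    ultimately show ?thesis using T d eq by simp
  qed
qed

end

text \<open>An intersection of the rings of integers of the discrete valuations other than
  \<open>v\<close>.\<close>

lemma field_subring_ring_away_from: "field_subring (ring_away_from (v :: 'a::field \<Rightarrow> int))"
proof -
  have eq: "ring_away_from v = {x. \<forall>w. discrete_valuation w \<and> \<not> same_prime w v \<longrightarrow> x \<in> {x. x = 0 \<or> w x \<ge> 0}}"
    by (auto simp: ring_away_from_def)
  have int: "field_subring {x. x = 0 \<or> w x \<ge> 0}" if "discrete_valuation w" for w :: "'a \<Rightarrow> int"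
    using that by (intro discrete_valued_field.field_subring_integers) unfold_locales
  show ?thesis
    unfolding eq
    using field_subring.one_mem[OF int] field_subring.diff_mem[OF int] field_subring.mult_mem[OF int]
    by unfold_locales blast+
qed

lemma periodic_integral:
  fixes \<phi> :: "'a::field poly"
  assumes "\<forall>i. coeff \<phi> i \<in> ring_away_from v" "degree \<phi> \<ge> 2" "inverse (lead_coeff \<phi>) \<in> ring_away_from v"
    and "x \<in> Per (poly \<phi>)"
  shows "x \<in> ring_away_from v"
proof (rule ccontr)
  assume "x \<notin> ring_away_from v"
  then obtain w where w: "discrete_valuation w" "\<not> same_prime w v" and x: "x \<noteq> 0" "w x < 0"
    by (auto simp: ring_away_from_def)
  interpret discrete_valued_field w by unfold_locales fact
  have coeff: "coeff \<phi> i = 0 \<or> w (coeff \<phi> i) \<ge> 0" for i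
    using assms(1) w by (auto simp: ring_away_from_def)
  have lead: "lead_coeff \<phi> \<noteq> 0" using assms(2) by auto
  moreover have "w (inverse (lead_coeff \<phi>)) \<ge> 0"
    using assms(3) w lead by (auto simp: ring_away_from_def)
  ultimately have lead_val: "w (lead_coeff \<phi>) = 0"
    using val_mult[of "lead_coeff \<phi>" "inverse (lead_coeff \<phi>)"] coeff[of "degree \<phi>"] val_1 by simp
  have iter: "(poly \<phi> ^^ Suc n) x \<noteq> 0 \<and> w ((poly \<phi> ^^ Suc n) x) < w x" for n
  proof (induction n)
    case 0
    then show ?case using val_poly_less[OF coeff lead_val assms(2) x] by simp
  next
    case (Suc n)
    then show ?case using val_poly_less[OF coeff lead_val assms(2), of "(poly \<phi> ^^ Suc n) x"] x by auto
  qed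
  obtain n where n: "n \<ge> 1" "(poly \<phi> ^^ n) x = x" using assms(4) by (auto simp: Per_def)
  thus False using iter[of "n - 1"] by simp
qed

section \<open>Difference quotients at periodic points\<close>

context field_subring
begin

lemma diff_dvd_poly_diff:
  assumes "f \<in> poly_over A" "x \<in> A" "y \<in> A"
  shows "\<exists>q\<in>A. poly f x - poly f y = q * (x - y)"
  using assms(1)
proof (induction f)
  case (pCons a p)
  then obtain q where q: "q \<in> A" "poly p x - poly p y = q * (x - y)" by (auto simp: poly_over_pCons)
  have "poly (pCons a p) x - poly (pCons a p) y = x * (poly p x - poly p y) + poly p y * (x - y)"
    by (simp add: algebra_simps)
  also have "\<dots> = (x * q + poly p y) * (x - y)" by (simp add: q(2) algebra_simps)
  finally show ?case
    using pCons.prems q(1) assms(2,3) by (auto simp: poly_over_pCons intro!: bexI add_mem mult_mem poly_mem)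
qed (auto intro: bexI[of _ 0] zero_mem)

lemma diff_dvd_iterate_diff:
  assumes "f \<in> poly_over A" "x \<in> A" "y \<in> A"
  shows "\<exists>q\<in>A. (poly f ^^ n) x - (poly f ^^ n) y = q * (x - y)"
  using assms(2,3)
proof (induction n arbitrary: x y)
  case 0
  show ?case using one_mem by (intro bexI[of _ 1]) auto
next
  case (Suc n)
  obtain q where q: "q \<in> A" "poly f x - poly f y = q * (x - y)"
    using diff_dvd_poly_diff[OF assms(1) Suc.prems] by blast
  obtain r where r: "r \<in> A" "(poly f ^^ n) (poly f x) - (poly f ^^ n) (poly f y) = r * (poly f x - poly f y)"
    using Suc.IH[of "poly f x" "poly f y"] poly_mem[OF assms(1)] Suc.prems by blast
  show ?case
    using q r by (intro bexI[of _ "r * q"]) (simp_all add: funpow_swap1 mult_mem mult.assoc)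
qed

text \<open>Along a common period, \<open>x - y\<close> divides \<open>f(x) - f(y)\<close>, which in turn divides \<open>x - y\<close>.\<close>

lemma periodic_quotient_unit:
  assumes f: "f \<in> poly_over A" and xy: "x \<in> A" "y \<in> A" "x \<noteq> y"
    and per: "x \<in> Per (poly f)" "y \<in> Per (poly f)"
  shows "\<exists>q\<in>A. q \<noteq> 0 \<and> inverse q \<in> A \<and> poly f x - poly f y = q * (x - y)"
proof -
  obtain m n where mn: "m \<ge> 1" "(poly f ^^ m) x = x" "n \<ge> 1" "(poly f ^^ n) y = y"
    using per by (auto simp: Per_def)
  have fix_pow: "(g ^^ (a * b)) z = z" if "(g ^^ a) z = z" for g :: "'a \<Rightarrow> 'a" and a b z
    using that by (induction b) (auto simp: funpow_add)
  have "(poly f ^^ (m * n)) x = x" "(poly f ^^ (m * n)) y = y"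
    using mn fix_pow[of m "poly f" x n] fix_pow[of n "poly f" y m] by (auto simp: mult.commute)
  moreover obtain k where "m * n = Suc k" using mn by (cases "m * n") auto
  \<comment> \<open>One application short of the common period \<open>m * n\<close>, the iterate
    carries \<open>f(x)\<close> back to \<open>x\<close> and \<open>f(y)\<close> back to
    \<open>y\<close>.\<close>
  ultimately have per': "(poly f ^^ k) (poly f x) = x" "(poly f ^^ k) (poly f y) = y"
    by (simp_all add: funpow_swap1)
  obtain q where q: "q \<in> A" "poly f x - poly f y = q * (x - y)"
    using diff_dvd_poly_diff[OF f xy(1,2)] by blast
  obtain r where r: "r \<in> A" "x - y = r * (poly f x - poly f y)"
    using diff_dvd_iterate_diff[OF f poly_mem[OF f xy(1)] poly_mem[OF f xy(2)], of k] per' by metis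
  have "x - y = q * r * (x - y)" using q r by simp
  hence "q * r = 1" using xy(3) by simp
  hence "q \<noteq> 0" "inverse q = r" by (auto intro: inverse_unique)
  thus ?thesis using q r by blast
qed

end

text \<open>Fix \<open>y\<close> in \<open>P\<close> and let \<open>g\<close> be the quotient of
  \<open>f - f(y)\<close> by \<open>X - y\<close>. Every other \<open>x\<close> in \<open>P\<close>
  is a root of some \<open>g - c\<close> with \<open>c \<in> C\<close>, of degree
  \<open>degree f - 1\<close>; the final 1 counts \<open>y\<close>.\<close>

lemma card_le_of_difference_quotients:
  fixes f :: "'a::field poly"
  assumes "finite C" "degree f \<ge> 2"
    and quot: "\<And>x y. x \<in> P \<Longrightarrow> y \<in> P \<Longrightarrow> x \<noteq> y \<Longrightarrow> \<exists>c\<in>C. poly f x - poly f y = c * (x - y)"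
  shows "finite P \<and> card P \<le> card C * (degree f - 1) + 1"
proof (cases "P = {}")
  case False
  then obtain y where y: "y \<in> P" by blast
  have "poly (f - [:poly f y:]) y = 0" by simp
  then obtain g where g: "f - [:poly f y:] = [:- y, 1:] * g"
    unfolding poly_eq_0_iff_dvd by (auto elim: dvdE)
  have "degree (f - [:poly f y:]) = degree f"
    using assms(2) degree_add_eq_left[of "[:- poly f y:]" f]
    by (simp add: diff_conv_add_uminus del: add_uminus_conv_diff)
  moreover from this have "g \<noteq> 0" using g assms(2) by (metis degree_0 mult_zero_right not_numeral_le_zero)
  ultimately have deg: "degree g = degree f - 1" unfolding g by (subst (asm) degree_mult_eq) auto
  define R where "R = (\<lambda>c. {x. poly (g - [:c:]) x = 0})"
  have R: "finite (R c) \<and> card (R c) \<le> degree f - 1" for c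
  proof -
    \<comment> \<open>As \<open>degree g \<ge> 1\<close>, subtracting a constant neither lowers the
      degree nor gives 0.\<close>
    have "degree (g - [:c:]) = degree f - 1" using deg assms(2) degree_add_eq_left[of "[:- c:]" g]
      by (simp add: diff_conv_add_uminus del: add_uminus_conv_diff)
    moreover from this have "g - [:c:] \<noteq> 0" using assms(2) by auto
    ultimately show ?thesis
      using poly_roots_finite[of "g - [:c:]"] card_poly_roots_bound[of "g - [:c:]"] by (simp add: R_def)
  qed
  have sub: "P \<subseteq> insert y (\<Union>c\<in>C. R c)"
  proof
    fix x assume x: "x \<in> P"
    show "x \<in> insert y (\<Union>c\<in>C. R c)"
    proof (cases "x = y")
      case False
      then obtain c where c: "c \<in> C" "poly f x - poly f y = c * (x - y)" using quot x y by blast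
      have "poly (f - [:poly f y:]) x = (x - y) * poly g x" unfolding g by (simp add: algebra_simps)
      hence "(x - y) * poly g x = (x - y) * c" using c(2) by auto
      hence "poly g x = c" using False by (metis mult_cancel_left right_minus_eq)
      thus ?thesis using c(1) by (auto simp: R_def)
    qed simp
  qed
  have fin: "finite (\<Union>c\<in>C. R c)" using assms(1) R by auto
  have "card P \<le> card (insert y (\<Union>c\<in>C. R c))" using sub fin by (intro card_mono) auto
  also have "\<dots> \<le> card (\<Union>c\<in>C. R c) + 1" using fin by (simp add: card_insert_if)
  also have "card (\<Union>c\<in>C. R c) \<le> (\<Sum>c\<in>C. card (R c))" using assms(1) by (rule card_UN_le)
  also have "\<dots> \<le> card C * (degree f - 1)" using R sum_bounded_above[of C "\<lambda>c. card (R c)"] by simp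
  finally show ?thesis using finite_subset[OF sub] fin by simp
qed simp

theorem theorem2p5:
  fixes vinf :: "'a::field \<Rightarrow> int" and \<phi> :: "'a poly" and q d :: nat
  assumes "global_function_field TYPE('a)"
    and "discrete_valuation vinf"
    and "q = card (constant_field :: 'a set)"
    and "\<forall>i. coeff \<phi> i \<in> ring_away_from vinf"
    and "d = degree \<phi>" and "d \<ge> 2"
    and "lead_coeff \<phi> \<noteq> 0"
    and "inverse (lead_coeff \<phi>) \<in> ring_away_from vinf"
  shows "finite (Per (poly \<phi>)) \<and> card (Per (poly \<phi>)) \<le> (q - 1) * (d - 1) + 1"
proof -
  obtain t :: 'a and B where "function_field t B"
    using assms(1) unfolding global_function_field_def function_field_def by blast
  then interpret function_field t B .
  let ?O = "ring_away_from vinf"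
  interpret O: field_subring ?O by (rule field_subring_ring_away_from)
  let ?C = "constant_field - {0 :: 'a}"
  \<comment> \<open>0 is a constant, being a root of \<open>X\<close>, so leaving it out lowers the
    cardinality from \<open>q\<close> to \<open>q - 1\<close>.\<close>
  have "[:0, 1:] \<in> poly_over F" by (simp add: F.poly_over_pCons F.poly_over_0 F.zero_mem F.one_mem)
  hence "(0 :: 'a) \<in> constant_field"
    unfolding constant_field_def by (auto intro!: bexI[of _ "[:0, 1:]"])
  hence card: "card ?C = q - 1" using finite_constant_field by (simp add: assms(3))
  have "finite (Per (poly \<phi>)) \<and> card (Per (poly \<phi>)) \<le> card ?C * (degree \<phi> - 1) + 1"
  proof (rule card_le_of_difference_quotients)
    fix x y assume per: "x \<in> Per (poly \<phi>)" "y \<in> Per (poly \<phi>)" and neq: "x \<noteq> y"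
    have O: "x \<in> ?O" "y \<in> ?O" using periodic_integral[of \<phi> vinf] assms(4-6,8) per by auto
    have "\<phi> \<in> poly_over ?O" using assms(4) by (simp add: poly_over_def)
    then obtain c where "c \<in> ?O" "c \<noteq> 0" "inverse c \<in> ?O" "poly \<phi> x - poly \<phi> y = c * (x - y)"
      using O.periodic_quotient_unit O neq per by blast
    thus "\<exists>c\<in>?C. poly \<phi> x - poly \<phi> y = c * (x - y)" using unit_away_from_constant by blast
  qed (use finite_constant_field assms(5,6) in auto)
  thus ?thesis by (simp add: card assms(5))
qed

end
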